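(* Let $G$ be a finite group acting by left multiplication on the set $\Omega$ of left cosets of a subgroup $H$. Assume that there are an intersecting set $S\subseteq G$ and a $(G,\Omega)$-compatible class function $f:G\to\mathbb{R}$ such that $$|S|=\frac{|G|(-\tau)}{d-\tau},$$ where $d=\sum_{g\in G}f(g)$ and $\tau$ is the least eigenvalue of the matrix $M^f$. Then: (a) $|S|$ is the size of a maximum intersecting set in $G$; and (b) the action of $G$ on $\Omega$ satisfies the EKR-module property if $$\left\{\chi\in\mathrm{Irr}(G) : \frac{1}{\chi(1)}\sum_{g\in G}f(g)\chi(g)=\tau\right\}\subseteq\left\{\chi\in\mathrm{Irr}(G) : \chi(\mathbf{v}_H)\neq 0\right\}.$$
   Context: Let $G$ be a finite group acting transitively on a set $\Omega$. Elements $\sigma,\tau\in G$ intersect if $\sigma\tau^{-1}$ fixes a point of $\Omega$; a subset of $G$ is an intersecting set if any two of its elements intersect; a maximum intersecting set is an intersecting set of maximum possible size. For $S\subseteq G$, $\mathbf{v}_S=\sum_{s\in S}s\in\mathbb{C}G$ is its characteristic vector in the group algebra. The canonical vectors are $\mathbf{v}_{\alpha,\beta}=\sum_{t\in G,\ t\cdot\alpha=\beta}t$ for $\alpha,\beta\in\Omega$. The action of $G$ on $\Omega$ satisfies the EKR-module property if the characteristic vector of each maximum intersecting set is a $\mathbb{C}$-linear combination of canonical vectors. A derangement is an element of $G$ fixing no point of $\Omega$; $Der(G,\Omega)$ is the set of derangements. A $(G,\Omega)$-compatible class function is a real-valued class function $f:G\to\mathbb{R}$ such that (i) $f(g)=0$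 for all $g\notin Der(G,\Omega)$, and (ii) $f(d)=f(d^{-1})$ for all $d\in Der(G,\Omega)$. $M^f$ is the real symmetric matrix indexed by $G\times G$ with entries $M^f_{g,h}=f(gh^{-1})$ (equivalently $f(g^{-1}h)$). $\mathrm{Irr}(G)$ is the set of irreducible complex characters of $G$, and $\chi(\mathbf{v}_A)=\sum_{a\in A}\chi(a)$ for $A\subseteq G$. The displayed quotient in the hypothesis is understood to be well defined, i.e. $d\neq\tau$. *)

theory Defs
  imports
    "HOL-Library.Indicator_Function"
    "HOL-Algebra.Group_Action"
    "HOL-Algebra.Left_Coset"
    "Jordan_Normal_Form.Char_Poly"
    "Jordan_Normal_Form.VS_Connect"
begin

section \<open>Intersecting sets and the EKR-module property\<close>

text \<open>An action is given as in \<^locale>\<open>group_action\<close>: a group \<open>G\<close>, a set \<open>\<Omega>\<close> and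
  \<open>\<phi> :: 'a \<Rightarrow> 'b \<Rightarrow> 'b\<close>, where \<open>\<phi> g \<alpha>\<close> is the image of the point \<open>\<alpha>\<close> under \<open>g\<close>.\<close>

definition derangements ::
  "[('a, 'c) monoid_scheme, 'b set, 'a \<Rightarrow> 'b \<Rightarrow> 'b] \<Rightarrow> 'a set" where
  "derangements G \<Omega> \<phi> = {g \<in> carrier G. invariants \<Omega> \<phi> g = {}}"

definition intersecting_set ::
  "[('a, 'c) monoid_scheme, 'b set, 'a \<Rightarrow> 'b \<Rightarrow> 'b, 'a set] \<Rightarrow> bool" where
  "intersecting_set G \<Omega> \<phi> S \<longleftrightarrow>
     S \<subseteq> carrier G \<and>
     (\<forall>\<sigma>\<in>S. \<forall>\<tau>\<in>S. \<exists>\<alpha>\<in>\<Omega>. \<phi> (\<sigma> \<otimes>\<^bsub>G\<^esub> inv\<^bsub>G\<^esub> \<tau>) \<alpha> = \<alpha>)"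

definition maximum_intersecting_set ::
  "[('a, 'c) monoid_scheme, 'b set, 'a \<Rightarrow> 'b \<Rightarrow> 'b, 'a set] \<Rightarrow> bool" where
  "maximum_intersecting_set G \<Omega> \<phi> S \<longleftrightarrow>
     intersecting_set G \<Omega> \<phi> S \<and>
     (\<forall>T. intersecting_set G \<Omega> \<phi> T \<longrightarrow> card T \<le> card S)"

text \<open>An element \<open>\<Sum>\<^sub>g c\<^sub>g g\<close> of the group algebra \<open>\<complex>G\<close> is represented by its coefficient
  function \<open>g \<mapsto> c\<^sub>g\<close>, which is zero outside \<open>carrier G\<close>.\<close>

definition char_vec :: "'a set \<Rightarrow> 'a \<Rightarrow> complex" where
  "char_vec S = indicator S"

definition canonical_vec ::
  "[('a, 'c) monoid_scheme, 'a \<Rightarrow> 'b \<Rightarrow> 'b, 'b, 'b] \<Rightarrow> 'a \<Rightarrow> complex" where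
  "canonical_vec G \<phi> \<alpha> \<beta> = char_vec {t \<in> carrier G. \<phi> t \<alpha> = \<beta>}"

text \<open>The linear combination below is meaningful for finite \<open>\<Omega>\<close> only
  (in particular for a transitive action of a finite group).\<close>

definition EKR_module_property ::
  "[('a, 'c) monoid_scheme, 'b set, 'a \<Rightarrow> 'b \<Rightarrow> 'b] \<Rightarrow> bool" where
  "EKR_module_property G \<Omega> \<phi> \<longleftrightarrow>
     (\<forall>S. maximum_intersecting_set G \<Omega> \<phi> S \<longrightarrow>
        (\<exists>c :: 'b \<Rightarrow> 'b \<Rightarrow> complex.
           char_vec S = (\<lambda>g. \<Sum>\<alpha>\<in>\<Omega>. \<Sum>\<beta>\<in>\<Omega>. c \<alpha> \<beta> * canonical_vec G \<phi> \<alpha> \<beta> g)))"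

section \<open>Left multiplication on left cosets\<close>

text \<open>Permutations in \<^const>\<open>BijGroup\<close> are extensional functions, hence the restriction.\<close>

definition lcoset_action :: "[('a, 'c) monoid_scheme, 'a set] \<Rightarrow> 'a \<Rightarrow> 'a set \<Rightarrow> 'a set" where
  "lcoset_action G H g = (\<lambda>X \<in> lcosets\<^bsub>G\<^esub> H. g <#\<^bsub>G\<^esub> X)"

lemma (in group) lcoset_action_transitive:
  assumes H: "subgroup H G"
  shows "transitive_action G (lcosets H) (lcoset_action G H)"
proof -
  have HG: "H \<subseteq> carrier G" using H by (rule subgroup.subset)
  have mem: "g <# X \<in> lcosets H" if "g \<in> carrier G" "X \<in> lcosets H" for g X
    using that HG by (auto simp: LCOSETS_def lcos_m_assoc intro!: bexI[of _ "g \<otimes> _"])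
  have sub: "X \<subseteq> carrier G" if "X \<in> lcosets H" for X
    using that HG by (auto simp: LCOSETS_def dest: l_coset_subset_G[OF HG])
  have inv1: "inv g <# (g <# X) = X" "g <# (inv g <# X) = X"
    if "g \<in> carrier G" "X \<in> lcosets H" for g X
    using that sub[OF that(2)] by (simp_all add: lcos_m_assoc lcos_mult_one)
  have bij: "lcoset_action G H g \<in> Bij (lcosets H)" if g: "g \<in> carrier G" for g
  proof -
    have "bij_betw (\<lambda>X. g <# X) (lcosets H) (lcosets H)"
      by (rule bij_betw_byWitness[where f' = "\<lambda>X. inv g <# X"]) (use g inv1 mem in auto)
    then have "bij_betw (lcoset_action G H g) (lcosets H) (lcosets H)"
      by (rule iffD1[OF bij_betw_cong, rotated]) (simp add: lcoset_action_def)
    then show ?thesis by (simp add: Bij_def lcoset_action_def)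
  qed
  have mult: "lcoset_action G H (g \<otimes> h) =
      compose (lcosets H) (lcoset_action G H g) (lcoset_action G H h)"
    if "g \<in> carrier G" "h \<in> carrier G" for g h
    using that sub mem
    by (auto simp: lcoset_action_def compose_def lcos_m_assoc restrict_def fun_eq_iff)
  have "lcoset_action G H \<in> hom G (BijGroup (lcosets H))"
    using bij mult by (auto simp: hom_def BijGroup_def)
  then have "group_action G (lcosets H) (lcoset_action G H)"
    by (simp add: group_action_def group_hom_def group_hom_axioms_def group_BijGroup group_axioms)
  moreover have "\<exists>g\<in>carrier G. lcoset_action G H g X = Y"
    if "X \<in> lcosets H" "Y \<in> lcosets H" for X Y
  proof -
    obtain a b where ab: "a \<in> carrier G" "b \<in> carrier G" "X = a <# H" "Y = b <# H"
      using \<open>X \<in> lcosets H\<close> \<open>Y \<in> lcosets H\<close> by (auto simp: LCOSETS_def)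
    then have "lcoset_action G H (b \<otimes> inv a) X = Y"
      using that HG by (simp add: lcoset_action_def lcos_m_assoc m_assoc)
    then show ?thesis using ab by blast
  qed
  ultimately show ?thesis
    by (simp add: transitive_action_def transitive_action_axioms_def)
qed

section \<open>Compatible class functions and their matrices\<close>

definition class_function :: "[('a, 'c) monoid_scheme, 'a \<Rightarrow> real] \<Rightarrow> bool" where
  "class_function G f \<longleftrightarrow>
     (\<forall>g\<in>carrier G. \<forall>x\<in>carrier G. f (x \<otimes>\<^bsub>G\<^esub> g \<otimes>\<^bsub>G\<^esub> inv\<^bsub>G\<^esub> x) = f g)"

definition compatible_class_function ::
  "[('a, 'c) monoid_scheme, 'b set, 'a \<Rightarrow> 'b \<Rightarrow> 'b, 'a \<Rightarrow> real] \<Rightarrow> bool" where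
  "compatible_class_function G \<Omega> \<phi> f \<longleftrightarrow>
     class_function G f \<and>
     (\<forall>g\<in>carrier G. g \<notin> derangements G \<Omega> \<phi> \<longrightarrow> f g = 0) \<and>
     (\<forall>d\<in>derangements G \<Omega> \<phi>. f d = f (inv\<^bsub>G\<^esub> d))"

definition class_function_matrix ::
  "[('a, 'c) monoid_scheme, 'a \<Rightarrow> real] \<Rightarrow> 'a \<Rightarrow> 'a \<Rightarrow> real" where
  "class_function_matrix G f g h = f (g \<otimes>\<^bsub>G\<^esub> inv\<^bsub>G\<^esub> h)"

text \<open>\<^const>\<open>eigenvalue\<close> is for matrices indexed by \<open>{0..<n}\<close>. The following is the same notion
  for a square matrix indexed by an arbitrary finite set \<open>I\<close>; the subsequent lemma shows that
  the two agree for every enumeration of \<open>I\<close>.\<close>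

definition eigenvalue_on :: "['i set, 'i \<Rightarrow> 'i \<Rightarrow> real, real] \<Rightarrow> bool" where
  "eigenvalue_on I M k \<longleftrightarrow>
     (\<exists>v :: 'i \<Rightarrow> real. (\<exists>i\<in>I. v i \<noteq> 0) \<and> (\<forall>i\<in>I. (\<Sum>j\<in>I. M i j * v j) = k * v i))"

lemma eigenvalue_on_iff_eigenvalue:
  assumes e: "bij_betw e {0..<n} I"
  shows "eigenvalue_on I M k \<longleftrightarrow> eigenvalue (mat n n (\<lambda>(i, j). M (e i) (e j))) k"
    (is "_ \<longleftrightarrow> eigenvalue ?A k")
proof
  have I: "I = e ` {0..<n}" using e by (simp add: bij_betw_def)
  have sum_I: "(\<Sum>j\<in>I. g j) = (\<Sum>j\<in>{0..<n}. g (e j))" for g :: "'a \<Rightarrow> real"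
    using sum.reindex_bij_betw[OF e, of g] by simp
  {
    assume "eigenvalue_on I M k"
    then obtain v where v: "\<exists>i\<in>I. v i \<noteq> 0" "\<forall>i\<in>I. (\<Sum>j\<in>I. M i j * v j) = k * v i"
      unfolding eigenvalue_on_def by blast
    have "eigenvector ?A (vec n (\<lambda>i. v (e i))) k"
      using v unfolding eigenvector_def
      by (auto simp: I sum_I scalar_prod_def vec_eq_iff)
        (auto simp: sum_I I[symmetric])
    then show "eigenvalue ?A k" unfolding eigenvalue_def by blast
  }
  {
    assume "eigenvalue ?A k"
    then obtain w where w: "w \<in> carrier_vec n" "w \<noteq> 0\<^sub>v n" "?A *\<^sub>v w = k \<cdot>\<^sub>v w"
      unfolding eigenvalue_def eigenvector_def by auto
    define v where "v = (\<lambda>x. w $ inv_into {0..<n} e x)"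
    have ve: "v (e i) = w $ i" if "i < n" for i
      using that bij_betw_inv_into_left[OF e, of i] by (simp add: v_def)
    obtain i where i: "i < n" "w $ i \<noteq> 0"
      using w(1,2) by (metis carrier_vecD eq_vecI index_zero_vec(1,2))
    have "(\<Sum>j\<in>{0..<n}. M (e l) (e j) * v (e j)) = k * v (e l)" if "l < n" for l
    proof -
      have "(?A *\<^sub>v w) $ l = (k \<cdot>\<^sub>v w) $ l" by (simp only: w(3))
      then show ?thesis using that w(1) ve by (simp add: scalar_prod_def)
    qed
    moreover have "\<exists>i\<in>I. v i \<noteq> 0" using i ve by (auto simp: I intro!: bexI[of _ i])
    ultimately show "eigenvalue_on I M k"
      unfolding eigenvalue_on_def sum_I by (intro exI[of _ v]) (simp add: I)
  }
qed

definition least_eigenvalue_on :: "['i set, 'i \<Rightarrow> 'i \<Rightarrow> real, real] \<Rightarrow> bool" where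
  "least_eigenvalue_on I M k \<longleftrightarrow>
     eigenvalue_on I M k \<and> (\<forall>l. eigenvalue_on I M l \<longrightarrow> k \<le> l)"

section \<open>Irreducible complex characters\<close>

definition GL_complex :: "nat \<Rightarrow> complex mat monoid" where
  "GL_complex n = units_of (ring_mat TYPE(complex) n ())"

definition matrix_representation ::
  "[('a, 'c) monoid_scheme, nat, 'a \<Rightarrow> complex mat] \<Rightarrow> bool" where
  "matrix_representation G n \<rho> \<longleftrightarrow> \<rho> \<in> hom G (GL_complex n)"

definition irreducible_representation ::
  "[('a, 'c) monoid_scheme, nat, 'a \<Rightarrow> complex mat] \<Rightarrow> bool" where
  "irreducible_representation G n \<rho> \<longleftrightarrow>
     matrix_representation G n \<rho> \<and> n > 0 \<and>
     (\<forall>W. VectorSpace.subspace class_ring W (module_vec TYPE(complex) n) \<and>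
          (\<forall>g\<in>carrier G. \<forall>w\<in>W. \<rho> g *\<^sub>v w \<in> W) \<longrightarrow>
          W = {0\<^sub>v n} \<or> W = carrier_vec n)"

definition character_of ::
  "[('a, 'c) monoid_scheme, nat, 'a \<Rightarrow> complex mat] \<Rightarrow> 'a \<Rightarrow> complex" where
  "character_of G n \<rho> = (\<lambda>g\<in>carrier G. \<Sum>i<n. \<rho> g $$ (i, i))"

definition Irr :: "('a, 'c) monoid_scheme \<Rightarrow> ('a \<Rightarrow> complex) set" where
  "Irr G = {character_of G n \<rho> | n \<rho>. irreducible_representation G n \<rho>}"

text \<open>The linear extension of \<open>\<chi>\<close> to \<open>\<complex>G\<close>, evaluated at \<open>char_vec A\<close>.\<close>

definition character_sum :: "('a \<Rightarrow> complex) \<Rightarrow> 'a set \<Rightarrow> complex" where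
  "character_sum \<chi> A = (\<Sum>a\<in>A. \<chi> a)"

end

theory Submission
  imports Defs "HOL-Analysis.Function_Topology"
begin

text \<open>Let \<open>M\<close> be the matrix of \<open>f\<close>; it is real symmetric with constant row sum \<open>d\<close>, and it acts on functions
  on \<open>G\<close> by convolution with \<open>f\<close>.

  For part (a) let \<open>v\<close> be the indicator of an intersecting set \<open>T\<close>. Compatibility of \<open>f\<close> gives
  \<open>\<langle>v, M v\<rangle> = 0\<close>. Splitting off the constant part of \<open>v\<close> and estimating the rest from below by the
  least eigenvalue \<open>\<tau>\<close> yields \<open>|T| \<le> |G| (- \<tau>) / (d - \<tau>)\<close> (lemma \<open>ratio_bound\<close>, which rests on the
  variational description \<open>least_eigenvalue_rayleigh\<close> of the least eigenvalue). The set \<open>S\<close> attains this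
  bound.

  For part (b) let \<open>T\<close> be a maximum intersecting set. By (a) it attains the bound as well, so its
  indicator \<open>v\<close> is the sum of a constant and an eigenvector of \<open>M\<close> for \<open>\<tau>\<close>. The canonical vectors are
  the indicators of the sets \<open>b H (inv a)\<close>, and their span \<open>J\<close> is the two-sided ideal generated by
  the sum of the elements of \<open>H\<close>.
  As \<open>f\<close> is central, the component \<open>b\<close> of \<open>v\<close> orthogonal to \<open>J\<close> is again an eigenvector for \<open>\<tau>\<close>
  (lemma \<open>in_canonical_span_if_shifted_eigenvector\<close>). Were \<open>b\<close> nonzero, the space of all eigenvectors
  for \<open>\<tau>\<close> orthogonal to \<open>J\<close> would contain an irreducible subrepresentation of the regular
  representation. Its character \<open>\<chi>\<close> would have \<open>f\<close>-eigenvalue \<open>\<tau>\<close>, and the sum of \<open>\<chi>\<close> over \<open>H\<close> would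
  vanish, because the sum of the elements of \<open>H\<close> acts as zero on functions orthogonal to \<open>J\<close>. This contradicts the inclusion in
  (b) (lemma \<open>vanishing_eigenfunction_eq_0\<close>).\<close>

section \<open>Rayleigh quotients of symmetric real matrices\<close>

text \<open>Vectors and matrices are functions on an index set \<open>I\<close>, as in \<^const>\<open>eigenvalue_on\<close>, so
  that \<open>I\<close> can be the group itself.\<close>

definition inner_on :: "'i set \<Rightarrow> ('i \<Rightarrow> real) \<Rightarrow> ('i \<Rightarrow> real) \<Rightarrow> real" where
  "inner_on I u v = (\<Sum>i\<in>I. u i * v i)"

definition apply_on :: "'i set \<Rightarrow> ('i \<Rightarrow> 'i \<Rightarrow> real) \<Rightarrow> ('i \<Rightarrow> real) \<Rightarrow> 'i \<Rightarrow> real" where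
  "apply_on I M v i = (\<Sum>j\<in>I. M i j * v j)"

lemma inner_on_commute: "inner_on I u v = inner_on I v u"
  by (simp add: inner_on_def mult.commute)

lemma inner_on_add_left: "inner_on I (\<lambda>i. u i + v i) w = inner_on I u w + inner_on I v w"
  by (simp add: inner_on_def sum.distrib algebra_simps)

lemma inner_on_diff_left: "inner_on I (\<lambda>i. u i - v i) w = inner_on I u w - inner_on I v w"
  by (simp add: inner_on_def sum_subtractf algebra_simps)

lemma inner_on_scale_left: "inner_on I (\<lambda>i. c * u i) w = c * inner_on I u w"
  by (simp add: inner_on_def sum_distrib_left algebra_simps)

lemma inner_on_add_right: "inner_on I w (\<lambda>i. u i + v i) = inner_on I w u + inner_on I w v"
  by (simp add: inner_on_def sum.distrib algebra_simps)

lemma inner_on_diff_right: "inner_on I w (\<lambda>i. u i - v i) = inner_on I w u - inner_on I w v"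
  by (simp add: inner_on_def sum_subtractf algebra_simps)

lemma inner_on_scale_right: "inner_on I w (\<lambda>i. c * u i) = c * inner_on I w u"
  by (simp add: inner_on_def sum_distrib_left algebra_simps)

lemma inner_on_sum_right: "inner_on I w (\<lambda>i. \<Sum>k\<in>K. c k * u k i) = (\<Sum>k\<in>K. c k * inner_on I w (u k))"
  unfolding inner_on_def sum_distrib_left
  by (subst sum.swap) (simp add: algebra_simps)

lemmas inner_on_linear =
  inner_on_add_left inner_on_diff_left inner_on_scale_left
  inner_on_add_right inner_on_diff_right inner_on_scale_right

lemma inner_on_self_nonneg: "0 \<le> inner_on I v v"
  by (simp add: inner_on_def sum_nonneg)

lemma inner_on_self_eq_0: "finite I \<Longrightarrow> inner_on I v v = 0 \<longleftrightarrow> (\<forall>i\<in>I. v i = 0)"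
  by (simp add: inner_on_def sum_nonneg_eq_0_iff)

lemma apply_on_add: "apply_on I M (\<lambda>i. u i + v i) = (\<lambda>i. apply_on I M u i + apply_on I M v i)"
  by (simp add: apply_on_def fun_eq_iff sum.distrib algebra_simps)

lemma apply_on_diff: "apply_on I M (\<lambda>i. u i - v i) = (\<lambda>i. apply_on I M u i - apply_on I M v i)"
  by (simp add: apply_on_def fun_eq_iff sum_subtractf algebra_simps)

lemma apply_on_scale: "apply_on I M (\<lambda>i. c * u i) = (\<lambda>i. c * apply_on I M u i)"
  by (simp add: apply_on_def fun_eq_iff sum_distrib_left algebra_simps)

lemma inner_on_apply_on_symmetric:
  assumes "\<And>i j. i \<in> I \<Longrightarrow> j \<in> I \<Longrightarrow> M i j = M j i"
  shows "inner_on I u (apply_on I M v) = inner_on I (apply_on I M u) v"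
proof -
  have "inner_on I u (apply_on I M v) = (\<Sum>i\<in>I. \<Sum>j\<in>I. u i * M i j * v j)"
    by (simp add: inner_on_def apply_on_def sum_distrib_left mult.assoc)
  also have "\<dots> = (\<Sum>j\<in>I. \<Sum>i\<in>I. u i * M j i * v j)"
    by (subst sum.swap) (intro sum.cong refl, simp add: assms)
  also have "\<dots> = inner_on I (apply_on I M u) v"
    by (simp add: inner_on_def apply_on_def sum_distrib_right sum_distrib_left mult_ac)
  finally show ?thesis .
qed

text \<open>The form \<open>Q v = \<langle>v, M v\<rangle> - k \<langle>v, v\<rangle>\<close> is nonnegative and vanishes at \<open>w\<close>. Along the line
  \<open>w + t x\<close> with \<open>x = M w - k w\<close> it is a quadratic polynomial in \<open>t\<close> without constant term and with
  linear coefficient \<open>2 \<langle>x, x\<rangle>\<close>; nonnegativity at small negative \<open>t\<close> forces \<open>x = 0\<close>.\<close>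

lemma eigenvector_if_rayleigh_minimum:
  assumes fin: "finite I"
    and sym: "\<And>i j. i \<in> I \<Longrightarrow> j \<in> I \<Longrightarrow> M i j = M j i"
    and bound: "\<And>v. k * inner_on I v v \<le> inner_on I v (apply_on I M v)"
    and attained: "inner_on I w (apply_on I M w) = k * inner_on I w w"
    and i: "i \<in> I"
  shows "apply_on I M w i = k * w i"
proof -
  define x where "x = (\<lambda>i. apply_on I M w i - k * w i)"
  define q where "q = inner_on I x x"
  define r where "r = inner_on I x (apply_on I M x) - k * inner_on I x x"
  have r0: "0 \<le> r" using bound[of x] by (simp add: r_def)
  have q_alt: "inner_on I x (apply_on I M w) - k * inner_on I x w = q"
    unfolding q_def by (subst (4) x_def) (simp add: inner_on_linear)
  have wx: "inner_on I w (apply_on I M x) = inner_on I x (apply_on I M w)"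
    by (subst inner_on_apply_on_symmetric[OF sym]) (auto simp: inner_on_commute)
  have pos: "0 \<le> 2 * t * q + t\<^sup>2 * r" for t
  proof -
    have "0 \<le> inner_on I (\<lambda>i. w i + t * x i) (apply_on I M (\<lambda>i. w i + t * x i)) -
        k * inner_on I (\<lambda>i. w i + t * x i) (\<lambda>i. w i + t * x i)"
      using bound by simp
    also have "\<dots> = 2 * t * (inner_on I x (apply_on I M w) - k * inner_on I x w) + t\<^sup>2 * r"
      using attained wx inner_on_commute[of I w x]
      by (simp add: apply_on_add apply_on_scale inner_on_linear r_def power2_eq_square algebra_simps)
    finally show ?thesis using q_alt by simp
  qed
  \<comment> \<open>At \<open>t = - q / (r + 1)\<close> the quadratic is \<open>- t\<^sup>2 (r + 2)\<close>, negative unless \<open>q = 0\<close>.\<close>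
  define u where "u = q / (r + 1)"
  have q: "q = u * (r + 1)" using r0 by (simp add: u_def)
  have "u\<^sup>2 * (r + 2) \<le> 0"
    using pos[of "- u"] by (simp add: q power2_eq_square algebra_simps)
  then have "u = 0" using r0 by (simp add: mult_le_0_iff)
  then have "q = 0" by (simp add: q)
  then show ?thesis
    using i inner_on_self_eq_0[OF fin, of x] by (simp add: q_def x_def)
qed

text \<open>Requiring the value \<open>0\<close> outside \<open>I\<close> makes the sphere a closed subset of a product of compact
  intervals and singletons, so that compactness follows from Tychonoff's theorem.\<close>

lemma compact_unit_sphere_on:
  fixes I :: "'i set"
  assumes fin: "finite I"
  shows "compact {v :: 'i \<Rightarrow> real. (\<forall>i. i \<notin> I \<longrightarrow> v i = 0) \<and> inner_on I v v = 1}" (is "compact ?S")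
proof -
  define B where "B = (\<lambda>i. if i \<in> I then {-1..1::real} else {0})"
  have "compactin (product_topology (\<lambda>i. euclidean) UNIV) (PiE UNIV B)"
    by (auto simp: compactin_PiE B_def)
  then have "compact (PiE UNIV B)"
    by (simp add: euclidean_product_topology)
  moreover have "closed {v :: 'i \<Rightarrow> real. inner_on I v v = 1}"
  proof -
    have "continuous_on UNIV (\<lambda>v :: 'i \<Rightarrow> real. inner_on I v v)"
      unfolding inner_on_def by (intro continuous_intros continuous_on_product_coordinates)
    then have "closed ((\<lambda>v :: 'i \<Rightarrow> real. inner_on I v v) -` {1})"
      by (intro closed_vimage) (auto simp: continuous_on_eq_continuous_at)
    then show ?thesis by (simp add: vimage_def)
  qed
  moreover have "?S = PiE UNIV B \<inter> {v. inner_on I v v = 1}"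
  proof -
    have "\<bar>v i\<bar> \<le> 1" if "inner_on I v v = 1" "i \<in> I" for v :: "'i \<Rightarrow> real" and i
    proof -
      have "v i * v i \<le> inner_on I v v"
        unfolding inner_on_def using fin that(2) by (intro member_le_sum) auto
      then show ?thesis
        using that(1) abs_square_le_1[of "v i"] by (simp add: power2_eq_square)
    qed
    then show ?thesis
      by (auto simp: B_def PiE_def Pi_def abs_le_iff split: if_splits)
  qed
  ultimately show ?thesis by (simp add: compact_Int_closed)
qed

text \<open>By compactness the Rayleigh quotient attains its minimum on the unit sphere. The minimiser is an
  eigenvector, so the minimum is an eigenvalue and hence at least \<open>k\<close>.\<close>

lemma least_eigenvalue_rayleigh:
  fixes M :: "'i \<Rightarrow> 'i \<Rightarrow> real"
  assumes fin: "finite I"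
    and sym: "\<And>i j. i \<in> I \<Longrightarrow> j \<in> I \<Longrightarrow> M i j = M j i"
    and least: "least_eigenvalue_on I M k"
  shows "k * inner_on I v v \<le> inner_on I v (apply_on I M v)"
proof -
  define S where "S = {v :: 'i \<Rightarrow> real. (\<forall>i. i \<notin> I \<longrightarrow> v i = 0) \<and> inner_on I v v = 1}"
  define Q where "Q = (\<lambda>v. inner_on I v (apply_on I M v))"
  have cont: "continuous_on S Q"
    unfolding Q_def inner_on_def apply_on_def
    by (intro continuous_intros continuous_on_subset[OF continuous_on_product_coordinates]) auto
  define normalise where
    "normalise = (\<lambda>v i. if i \<in> I then (1 / sqrt (inner_on I v v)) * v i else (0::real))"
  have on_I: "inner_on I (normalise v) w = 1 / sqrt (inner_on I v v) * inner_on I v w"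
      "inner_on I w (normalise v) = 1 / sqrt (inner_on I v v) * inner_on I w v"
      "apply_on I M (normalise v) = (\<lambda>i. 1 / sqrt (inner_on I v v) * apply_on I M v i)" for v w
  proof -
    define c where "c = 1 / sqrt (inner_on I v v)"
    have *: "normalise v i = c * v i" if "i \<in> I" for i
      using that by (simp add: normalise_def c_def)
    show "inner_on I (normalise v) w = 1 / sqrt (inner_on I v v) * inner_on I v w"
      "inner_on I w (normalise v) = 1 / sqrt (inner_on I v v) * inner_on I w v"
      "apply_on I M (normalise v) = (\<lambda>i. 1 / sqrt (inner_on I v v) * apply_on I M v i)"
      unfolding c_def[symmetric]
      by (simp_all add: inner_on_def apply_on_def * sum_distrib_left fun_eq_iff mult_ac)
  qed
  have normalise: "normalise v \<in> S" "Q v = inner_on I v v * Q (normalise v)"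
    if "inner_on I v v \<noteq> 0" for v
  proof -
    have pos: "0 < inner_on I v v" using that inner_on_self_nonneg[of I v] by linarith
    then have sq: "1 / sqrt (inner_on I v v) * (1 / sqrt (inner_on I v v)) = 1 / inner_on I v v"
      by simp
    have "inner_on I (normalise v) (normalise v) = 1"
      using pos by (simp add: on_I)
    moreover have "normalise v i = 0" if "i \<notin> I" for i
      using that by (simp add: normalise_def)
    ultimately show "normalise v \<in> S" by (simp add: S_def)
    have "Q (normalise v) = 1 / inner_on I v v * Q v"
      unfolding Q_def on_I inner_on_scale_right mult.assoc[symmetric] sq ..
    then show "Q v = inner_on I v v * Q (normalise v)" using pos by simp
  qed
  have "S \<noteq> {}"
  proof -
    obtain u :: "'i \<Rightarrow> real" where "\<exists>i\<in>I. u i \<noteq> 0"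
      using least by (auto simp: least_eigenvalue_on_def eigenvalue_on_def)
    then have "inner_on I u u \<noteq> 0" using inner_on_self_eq_0[OF fin] by blast
    then show ?thesis using normalise(1) by blast
  qed
  then obtain w where w: "w \<in> S" and min: "\<And>v. v \<in> S \<Longrightarrow> Q w \<le> Q v"
    using continuous_attains_inf[OF compact_unit_sphere_on[OF fin, folded S_def] _ cont] by blast
  have bound: "Q w * inner_on I v v \<le> Q v" for v
  proof (cases "inner_on I v v = 0")
    case True
    then have "v i = 0" if "i \<in> I" for i using inner_on_self_eq_0[OF fin] that by blast
    then have "Q v = 0" unfolding Q_def inner_on_def by (intro sum.neutral) simp
    with True show ?thesis by simp
  next
    case False
    have "inner_on I v v * Q w \<le> inner_on I v v * Q (normalise v)"
      by (intro mult_left_mono min normalise(1)[OF False] inner_on_self_nonneg)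
    also have "\<dots> = Q v" by (rule normalise(2)[OF False, symmetric])
    finally show ?thesis by (simp only: mult.commute)
  qed
  have w1: "inner_on I w w = 1" using w by (simp add: S_def)
  have "eigenvalue_on I M (Q w)"
    unfolding eigenvalue_on_def
  proof (intro exI[of _ w] conjI ballI)
    show "\<exists>i\<in>I. w i \<noteq> 0" using w1 inner_on_self_eq_0[OF fin, of w] by (metis zero_neq_one)
    show "(\<Sum>j\<in>I. M i j * w j) = Q w * w i" if "i \<in> I" for i
    proof -
      have "apply_on I M w i = Q w * w i"
      proof (rule eigenvector_if_rayleigh_minimum[OF fin])
        show "Q w * inner_on I v v \<le> inner_on I v (apply_on I M v)" for v
          using bound[of v] by (simp only: Q_def)
        show "inner_on I w (apply_on I M w) = Q w * inner_on I w w"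
          unfolding w1 by (simp only: Q_def mult_1_right)
      qed (use sym that in auto)
      then show ?thesis by (simp only: apply_on_def)
    qed
  qed
  then have "k \<le> Q w" using least by (simp add: least_eigenvalue_on_def)
  then have "k * inner_on I v v \<le> Q w * inner_on I v v"
    by (intro mult_right_mono inner_on_self_nonneg)
  with bound[of v] show ?thesis by (simp add: Q_def)
qed

section \<open>Orthogonal decomposition\<close>

text \<open>Projection onto the span of a finite family that may be linearly dependent, by Gram-Schmidt: a new
  vector \<open>u\<^sub>k = p + r\<close> is split into its projection \<open>p\<close> onto the span of the old ones and a
  remainder \<open>r\<close>, and the component of \<open>v\<close> along \<open>r\<close> is removed.\<close>

lemma orthogonal_decomposition:
  fixes u :: "'k \<Rightarrow> 'i \<Rightarrow> real"
  assumes finI: "finite I" and "finite K"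
  shows "\<exists>c. \<forall>k\<in>K. inner_on I (\<lambda>i. v i - (\<Sum>l\<in>K. c l * u l i)) (u k) = 0"
  using \<open>finite K\<close>
proof (induction K arbitrary: v rule: finite_induct)
  case (insert k K)
  obtain a where a: "\<And>l. l \<in> K \<Longrightarrow> inner_on I (\<lambda>i. v i - (\<Sum>l\<in>K. a l * u l i)) (u l) = 0"
    using insert.IH[of v] by blast
  obtain b where b: "\<And>l. l \<in> K \<Longrightarrow> inner_on I (\<lambda>i. u k i - (\<Sum>l\<in>K. b l * u l i)) (u l) = 0"
    using insert.IH[of "u k"] by blast
  define s where "s = (\<lambda>i. v i - (\<Sum>l\<in>K. a l * u l i))"
  define p where "p = (\<lambda>i. \<Sum>l\<in>K. b l * u l i)"
  define r where "r = (\<lambda>i. u k i - p i)"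
  \<comment> \<open>If \<open>r = 0\<close> then \<open>u\<^sub>k\<close> already lies in the span, and no correction is made.\<close>
  define t where "t = (if inner_on I r r = 0 then 0 else inner_on I s r / inner_on I r r)"
  define c where "c = (\<lambda>l. if l = k then t else a l - t * b l)"
  have c: "(\<lambda>i. v i - (\<Sum>l\<in>insert k K. c l * u l i)) = (\<lambda>i. s i - t * r i)"
  proof
    fix i
    have "(\<Sum>l\<in>K. c l * u l i) = (\<Sum>l\<in>K. a l * u l i) - t * p i"
      using insert.hyps
      by (auto simp: c_def p_def sum_distrib_left sum_subtractf[symmetric] algebra_simps intro!: sum.cong)
    then show "v i - (\<Sum>l\<in>insert k K. c l * u l i) = s i - t * r i"
      using insert.hyps by (simp add: s_def r_def c_def algebra_simps)
  qed
  have perp: "inner_on I s (u l) = 0" "inner_on I r (u l) = 0" if "l \<in> K" for l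
    using a[OF that] b[OF that] by (simp_all add: s_def r_def p_def)
  have perp_p: "inner_on I s p = 0" "inner_on I r p = 0"
    by (simp_all add: p_def inner_on_sum_right perp)
  have uk: "u k = (\<lambda>i. p i + r i)" by (simp add: r_def)
  have "inner_on I s r = 0" if "inner_on I r r = 0"
    using that inner_on_self_eq_0[OF finI, of r] by (simp add: inner_on_def)
  then have "inner_on I (\<lambda>i. s i - t * r i) r = 0"
    by (simp add: inner_on_linear t_def)
  then have "inner_on I (\<lambda>i. s i - t * r i) (u k) = 0"
    unfolding uk using perp_p by (simp add: inner_on_linear)
  moreover have "inner_on I (\<lambda>i. s i - t * r i) (u l) = 0" if "l \<in> K" for l
    using perp[OF that] by (simp add: inner_on_linear)
  ultimately show ?case unfolding c[symmetric] by blast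
qed simp

section \<open>Irreducible subrepresentations\<close>

text \<open>The predicate below is \<^const>\<open>VectorSpace.subspace\<close> for \<open>\<complex>\<^sup>n\<close>, unfolded to closure
  properties. A subspace is handled through a matrix \<open>P\<close> whose columns are a basis: \<open>P\<close> is injective
  and its range is the subspace. A subrepresentation is then a representation \<open>\<sigma>\<close> that is intertwined
  with the given one by \<open>P\<close>, that is, \<open>\<rho> g * P = P * \<sigma> g\<close>.\<close>

definition linear_subspace :: "nat \<Rightarrow> complex vec set \<Rightarrow> bool" where
  "linear_subspace n W \<longleftrightarrow> W \<subseteq> carrier_vec n \<and> 0\<^sub>v n \<in> W \<and>
     (\<forall>v\<in>W. \<forall>w\<in>W. v + w \<in> W) \<and> (\<forall>c. \<forall>v\<in>W. c \<cdot>\<^sub>v v \<in> W)"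

lemma linear_subspace_if_subspace:
  assumes "VectorSpace.subspace class_ring W (module_vec TYPE(complex) n)"
  shows "linear_subspace n W"
proof -
  interpret submodule class_ring W "module_vec TYPE(complex) n"
    using assms by (simp add: VectorSpace.subspace_def)
  show ?thesis
    using subset m_closed zero_closed smult_closed
    by (simp add: linear_subspace_def module_vec_simps class_ring_simps)
qed

definition injective_mat :: "nat \<Rightarrow> nat \<Rightarrow> complex mat \<Rightarrow> bool" where
  "injective_mat n m P \<longleftrightarrow> P \<in> carrier_mat n m \<and>
     (\<forall>v\<in>carrier_vec m. P *\<^sub>v v = 0\<^sub>v n \<longrightarrow> v = 0\<^sub>v m)"

lemma mat_mult_unit_vec:
  fixes P :: "complex mat"
  assumes "P \<in> carrier_mat n m" and "j < m"
  shows "P *\<^sub>v unit_vec m j = col P j"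
  using col_mult2[OF assms(1) one_carrier_mat[of m] assms(2)] assms(2)
  by (simp add: right_mult_one_mat[OF assms(1)])

lemma injective_mat_cancel_vec:
  assumes P: "injective_mat n m P" and v: "v \<in> carrier_vec m" and w: "w \<in> carrier_vec m"
    and eq: "P *\<^sub>v v = P *\<^sub>v w"
  shows "v = w"
proof -
  have Pc: "P \<in> carrier_mat n m" using P by (simp add: injective_mat_def)
  have "P *\<^sub>v (v - w) = P *\<^sub>v v - P *\<^sub>v w"
    by (rule mult_minus_distrib_mat_vec[OF Pc v w])
  then have "P *\<^sub>v (v - w) = 0\<^sub>v n"
    using mult_mat_vec_carrier[OF Pc w] by (simp add: eq)
  then have diff: "v - w = 0\<^sub>v m"
    using P v w by (simp add: injective_mat_def)
  show ?thesis
  proof (rule eq_vecI)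
    fix i assume i: "i < dim_vec w"
    have "(v - w) $ i = 0\<^sub>v m $ i" by (simp only: diff)
    then show "v $ i = w $ i" using i v w by simp
  qed (use v w in simp)
qed

lemma injective_mat_cancel:
  assumes P: "injective_mat n m P" and A: "A \<in> carrier_mat m k" and B: "B \<in> carrier_mat m k"
    and eq: "P * A = P * B"
  shows "A = B"
proof (rule mat_col_eqI)
  fix j assume "j < dim_col B"
  then have j: "j < k" using B by simp
  have Pc: "P \<in> carrier_mat n m" using P by (simp add: injective_mat_def)
  have "P *\<^sub>v col A j = P *\<^sub>v col B j"
    using col_mult2[OF Pc A j] col_mult2[OF Pc B j] eq by simp
  then show "col A j = col B j"
    by (rule injective_mat_cancel_vec[OF P, rotated 2]) (use A B in auto)
qed (use A B in auto)

lemma injective_mat_mult: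
  assumes P: "injective_mat n m P" and Q: "injective_mat m k Q"
  shows "injective_mat n k (P * Q)"
  unfolding injective_mat_def
proof (intro conjI ballI impI)
  have c: "P \<in> carrier_mat n m" "Q \<in> carrier_mat m k"
    using P Q by (simp_all add: injective_mat_def)
  then show "P * Q \<in> carrier_mat n k" by simp
  fix v :: "complex vec" assume v: "v \<in> carrier_vec k" and "P * Q *\<^sub>v v = 0\<^sub>v n"
  then have "P *\<^sub>v (Q *\<^sub>v v) = 0\<^sub>v n" using assoc_mult_mat_vec[OF c v] by simp
  then have "Q *\<^sub>v v = 0\<^sub>v m"
    using P mult_mat_vec_carrier[OF c(2) v] by (simp add: injective_mat_def)
  then show "v = 0\<^sub>v k" using Q v by (simp add: injective_mat_def)
qed

text \<open>A matrix with more columns than rows becomes a square matrix with a zero row when padded; its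
  determinant vanishes, so it has a nonzero kernel vector.\<close>

lemma injective_mat_le:
  assumes P: "injective_mat n m P"
  shows "m \<le> n"
proof (rule ccontr)
  assume "\<not> m \<le> n"
  then have nm: "n < m" by simp
  have Pc: "P \<in> carrier_mat n m" using P by (simp add: injective_mat_def)
  define r where "r = (\<lambda>i. if i < n then row P i else 0\<^sub>v m)"
  define Q where "Q = mat\<^sub>r m m (\<lambda>i. if i = n then 0\<^sub>v m else r i)"
  have Qc: "Q \<in> carrier_mat m m" by (simp add: Q_def)
  have r: "r i \<in> carrier_vec m" for i using Pc by (simp add: r_def)
  have "det Q = 0" unfolding Q_def by (rule det_row_0[OF nm]) (use r in auto)
  then obtain v where v: "v \<in> carrier_vec m" "v \<noteq> 0\<^sub>v m" "Q *\<^sub>v v = 0\<^sub>v m"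
    using det_0_iff_vec_prod_zero[OF Qc] by blast
  have "P *\<^sub>v v = 0\<^sub>v n"
  proof (rule eq_vecI)
    fix i assume "i < dim_vec (0\<^sub>v n :: complex vec)"
    then have i: "i < n" by simp
    have "row Q i = row P i"
      using i nm Pc by (intro eq_vecI) (auto simp: Q_def r_def)
    moreover have "(Q *\<^sub>v v) $ i = 0" using v i nm by simp
    ultimately show "(P *\<^sub>v v) $ i = 0\<^sub>v n $ i"
      using i nm Pc Qc by simp
  qed (use Pc in simp)
  then show False using P v by (simp add: injective_mat_def)
qed

lemma injective_square_mat_surj:
  assumes P: "injective_mat n n P" and u: "u \<in> carrier_vec n"
  shows "\<exists>v\<in>carrier_vec n. P *\<^sub>v v = u"
proof -
  have Pc: "P \<in> carrier_mat n n" using P by (simp add: injective_mat_def)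
  have "det P \<noteq> 0"
    using P det_0_iff_vec_prod_zero[OF Pc] by (auto simp: injective_mat_def)
  then obtain B where B: "B \<in> carrier_mat n n" "P * B = 1\<^sub>m n"
    using det_non_zero_imp_unit[OF Pc, of "()"] by (auto simp: Units_def ring_mat_simps)
  then have "P *\<^sub>v (B *\<^sub>v u) = u"
    using assoc_mult_mat_vec[OF Pc B(1) u] u by simp
  then show ?thesis using B(1) u by (intro bexI[of _ "B *\<^sub>v u"]) auto
qed

text \<open>Every subspace has a basis: among the injective matrices with range inside \<open>W\<close> take one with the
  largest number of columns. If it missed a vector of \<open>W\<close>, that vector could be appended as a further
  column.\<close>

lemma linear_subspace_eq_range:
  assumes W: "linear_subspace n W"
  obtains m P where "injective_mat n m P" and "W = (\<lambda>c. P *\<^sub>v c) ` carrier_vec m"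
proof -
  define ok where "ok = (\<lambda>m. \<exists>P. injective_mat n m P \<and> (\<forall>c\<in>carrier_vec m. P *\<^sub>v c \<in> W))"
  have Wc: "W \<subseteq> carrier_vec n" and W0: "0\<^sub>v n \<in> W"
    and Wadd: "\<And>v w. v \<in> W \<Longrightarrow> w \<in> W \<Longrightarrow> v + w \<in> W"
    and Wsmult: "\<And>c v. v \<in> W \<Longrightarrow> c \<cdot>\<^sub>v v \<in> W"
    using W by (auto simp: linear_subspace_def)
  have "0\<^sub>m n 0 *\<^sub>v c = 0\<^sub>v n" if "c \<in> carrier_vec 0" for c :: "complex vec"
    using that by (intro eq_vecI) (auto simp: scalar_prod_def)
  then have "ok 0"
    unfolding ok_def using W0 by (intro exI[of _ "0\<^sub>m n 0"]) (auto simp: injective_mat_def)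
  moreover have "\<forall>m. ok m \<longrightarrow> m \<le> n" using injective_mat_le by (auto simp: ok_def)
  ultimately obtain m where m: "ok m" and max: "\<And>k. ok k \<Longrightarrow> k \<le> m"
    using Nat.ex_has_greatest_nat[of ok 0 n] by blast
  then obtain P where P: "injective_mat n m P" and PW: "\<And>c. c \<in> carrier_vec m \<Longrightarrow> P *\<^sub>v c \<in> W"
    by (auto simp: ok_def)
  have Pc: "P \<in> carrier_mat n m" using P by (simp add: injective_mat_def)
  have "w \<in> (\<lambda>c. P *\<^sub>v c) ` carrier_vec m" if w: "w \<in> W" for w
  proof (rule ccontr)
    assume new: "w \<notin> (\<lambda>c. P *\<^sub>v c) ` carrier_vec m"
    have wc: "w \<in> carrier_vec n" using w Wc by blast
    define Q where "Q = mat n (Suc m) (\<lambda>(i, j). if j < m then P $$ (i, j) else w $ i)"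
    \<comment> \<open>\<open>Q\<close> is \<open>P\<close> with the additional column \<open>w\<close>; \<open>trunc\<close> drops the last coordinate.\<close>
    define trunc where "trunc = (\<lambda>c :: complex vec. vec m (\<lambda>j. c $ j))"
    have Qc: "Q \<in> carrier_mat n (Suc m)" by (simp add: Q_def)
    have trunc: "trunc c \<in> carrier_vec m" for c by (simp add: trunc_def)
    have Q: "Q *\<^sub>v c = P *\<^sub>v trunc c + c $ m \<cdot>\<^sub>v w" if c: "c \<in> carrier_vec (Suc m)" for c
    proof (rule eq_vecI)
      fix i assume "i < dim_vec (P *\<^sub>v trunc c + c $ m \<cdot>\<^sub>v w)"
      then have i: "i < n" using wc by simp
      have "(Q *\<^sub>v c) $ i = (\<Sum>j\<in>{0..<Suc m}. (if j < m then P $$ (i, j) else w $ i) * c $ j)"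
        using i c by (auto simp: Q_def scalar_prod_def intro!: sum.cong)
      also have "\<dots> = (\<Sum>j\<in>{0..<m}. P $$ (i, j) * c $ j) + w $ i * c $ m"
        by (simp add: sum.atLeast0_lessThan_Suc)
      also have "\<dots> = (P *\<^sub>v trunc c + c $ m \<cdot>\<^sub>v w) $ i"
        using i Pc wc by (simp add: trunc_def scalar_prod_def)
      finally show "(Q *\<^sub>v c) $ i = (P *\<^sub>v trunc c + c $ m \<cdot>\<^sub>v w) $ i" .
    qed (use Qc wc in simp)
    have "injective_mat n (Suc m) Q"
      unfolding injective_mat_def
    proof (intro conjI ballI impI)
      fix c :: "complex vec" assume c: "c \<in> carrier_vec (Suc m)" and Qz: "Q *\<^sub>v c = 0\<^sub>v n"
      have comp: "(P *\<^sub>v trunc c) $ i + c $ m * w $ i = 0" if "i < n" for i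
      proof -
        have "(P *\<^sub>v trunc c + c $ m \<cdot>\<^sub>v w) $ i = 0"
          unfolding Q[OF c, symmetric] Qz using that by simp
        then show ?thesis using that wc Pc by simp
      qed
      have cm: "c $ m = 0"
      proof (rule ccontr)
        assume nz: "c $ m \<noteq> 0"
        have "P *\<^sub>v ((- 1 / c $ m) \<cdot>\<^sub>v trunc c) = w"
        proof (rule eq_vecI)
          fix i assume "i < dim_vec w"
          then have i: "i < n" using wc by simp
          have "(P *\<^sub>v ((- 1 / c $ m) \<cdot>\<^sub>v trunc c)) $ i = (- 1 / c $ m) * (P *\<^sub>v trunc c) $ i"
            using mult_mat_vec[OF Pc trunc, of "- 1 / c $ m" c] i Pc by simp
          also have "(P *\<^sub>v trunc c) $ i = - (c $ m * w $ i)"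
            using comp[OF i] by (simp add: eq_neg_iff_add_eq_0)
          finally show "(P *\<^sub>v ((- 1 / c $ m) \<cdot>\<^sub>v trunc c)) $ i = w $ i" using nz by simp
        qed (use Pc wc in simp)
        then show False using new trunc[of c] by (auto simp: image_iff)
      qed
      have "P *\<^sub>v trunc c = 0\<^sub>v n"
        using comp cm Pc by (intro eq_vecI) auto
      then have t0: "trunc c = 0\<^sub>v m" using P trunc by (simp add: injective_mat_def)
      show "c = 0\<^sub>v (Suc m)"
      proof (rule eq_vecI)
        fix i assume "i < dim_vec (0\<^sub>v (Suc m) :: complex vec)"
        then have i: "i < m \<or> i = m" by auto
        have "trunc c $ i = 0\<^sub>v m $ i" by (simp only: t0)
        then show "c $ i = 0\<^sub>v (Suc m) $ i" using i cm by (auto simp: trunc_def)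
      qed (use c in simp)
    qed (rule Qc)
    moreover have "Q *\<^sub>v c \<in> W" if "c \<in> carrier_vec (Suc m)" for c
      using Q[OF that] Wadd[OF PW[OF trunc] Wsmult[OF w]] by simp
    ultimately have "ok (Suc m)" by (auto simp: ok_def)
    then show False using max by fastforce
  qed
  then have "W = (\<lambda>c. P *\<^sub>v c) ` carrier_vec m" using PW by auto
  with P show ?thesis by (rule that)
qed

text \<open>Multiplicativity and \<open>\<rho> 1 = 1\<close> suffice for values in the general linear group, since \<open>\<rho> g\<close>
  then has the inverse \<open>\<rho> (inv g)\<close>.\<close>

lemma matrix_representationI:
  assumes "group G"
    and carr: "\<And>g. g \<in> carrier G \<Longrightarrow> \<rho> g \<in> carrier_mat n n"
    and one: "\<rho> \<one>\<^bsub>G\<^esub> = 1\<^sub>m n"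
    and mult: "\<And>g h. g \<in> carrier G \<Longrightarrow> h \<in> carrier G \<Longrightarrow> \<rho> (g \<otimes>\<^bsub>G\<^esub> h) = \<rho> g * \<rho> h"
  shows "matrix_representation G n \<rho>"
proof -
  interpret group G by fact
  have "\<rho> g \<in> Units (ring_mat TYPE(complex) n ())" if g: "g \<in> carrier G" for g
  proof -
    have "\<rho> (inv\<^bsub>G\<^esub> g) * \<rho> g = 1\<^sub>m n" "\<rho> g * \<rho> (inv\<^bsub>G\<^esub> g) = 1\<^sub>m n"
      using mult[of "inv\<^bsub>G\<^esub> g" g] mult[of g "inv\<^bsub>G\<^esub> g"] g one by simp_all
    then show ?thesis
      using carr[OF g] carr[of "inv\<^bsub>G\<^esub> g"] g by (auto simp: Units_def ring_mat_simps)
  qed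
  then show ?thesis
    unfolding matrix_representation_def GL_complex_def hom_def
    by (auto simp: units_of_carrier units_of_mult ring_mat_simps mult)
qed

lemma matrix_representationD:
  assumes "group G" and rep: "matrix_representation G n \<rho>"
  shows "g \<in> carrier G \<Longrightarrow> \<rho> g \<in> carrier_mat n n"
    and "\<rho> \<one>\<^bsub>G\<^esub> = 1\<^sub>m n"
    and "g \<in> carrier G \<Longrightarrow> h \<in> carrier G \<Longrightarrow> \<rho> (g \<otimes>\<^bsub>G\<^esub> h) = \<rho> g * \<rho> h"
proof -
  interpret group G by fact
  interpret R: ring "ring_mat TYPE(complex) n ()" by (rule ring_mat)
  have hom: "\<rho> \<in> hom G (GL_complex n)" using rep by (simp add: matrix_representation_def)
  show "g \<in> carrier G \<Longrightarrow> \<rho> g \<in> carrier_mat n n"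
    using hom R.Units_closed[of "\<rho> g"]
    by (auto simp: hom_def GL_complex_def units_of_carrier ring_mat_simps Pi_def)
  show "g \<in> carrier G \<Longrightarrow> h \<in> carrier G \<Longrightarrow> \<rho> (g \<otimes>\<^bsub>G\<^esub> h) = \<rho> g * \<rho> h"
    using hom by (simp add: hom_def GL_complex_def units_of_mult ring_mat_simps)
  have "\<rho> \<one>\<^bsub>G\<^esub> = \<one>\<^bsub>GL_complex n\<^esub>"
    using hom_one[OF hom] R.units_group by (simp add: GL_complex_def group_axioms)
  then show "\<rho> \<one>\<^bsub>G\<^esub> = 1\<^sub>m n"
    by (simp add: GL_complex_def units_of_one ring_mat_simps)
qed

text \<open>The columns of \<open>\<sigma> g\<close> are the coordinates of the images under \<open>\<rho> g\<close> of the basis vectors. As \<open>P\<close>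
  can be cancelled on the left, the homomorphism property passes from \<open>\<rho>\<close> to \<open>\<sigma>\<close>.\<close>

lemma subrepresentation_on_invariant_subspace:
  assumes G: "group G" and rep: "matrix_representation G n \<rho>"
    and P: "injective_mat n m P"
    and inv: "\<And>g c. g \<in> carrier G \<Longrightarrow> c \<in> carrier_vec m \<Longrightarrow>
      \<rho> g *\<^sub>v (P *\<^sub>v c) \<in> (\<lambda>c. P *\<^sub>v c) ` carrier_vec m"
  obtains \<sigma> where "matrix_representation G m \<sigma>"
    and "\<forall>g\<in>carrier G. \<rho> g * P = P * \<sigma> g"
proof -
  interpret group G by fact
  note D = matrix_representationD[OF G rep]
  have Pc: "P \<in> carrier_mat n m" using P by (simp add: injective_mat_def)
  have "\<exists>B. B \<in> carrier_mat m m \<and> \<rho> g * P = P * B" if g: "g \<in> carrier G" for g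
  proof -
    have "\<exists>c. c \<in> carrier_vec m \<and> P *\<^sub>v c = \<rho> g *\<^sub>v col P j" if "j < m" for j
      using inv[OF g unit_vec_carrier[of m j]] mat_mult_unit_vec[OF Pc that] by force
    then obtain c where c: "\<And>j. j < m \<Longrightarrow> c j \<in> carrier_vec m"
        "\<And>j. j < m \<Longrightarrow> P *\<^sub>v c j = \<rho> g *\<^sub>v col P j" by metis
    define B where "B = mat m m (\<lambda>(i, j). c j $ i)"
    have Bc: "B \<in> carrier_mat m m" by (simp add: B_def)
    have "\<rho> g * P = P * B"
    proof (rule mat_col_eqI)
      fix j assume "j < dim_col (P * B)"
      then have j: "j < m" by (simp add: B_def)
      have "col B j = c j" using c(1)[OF j] j by (intro eq_vecI) (auto simp: B_def)
      then show "col (\<rho> g * P) j = col (P * B) j"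
        using col_mult2[OF D(1)[OF g] Pc j] col_mult2[OF Pc Bc j] c(2)[OF j] by simp
    qed (use D(1)[OF g] Pc Bc in auto)
    with Bc show ?thesis by blast
  qed
  then obtain \<sigma> where \<sigma>: "\<And>g. g \<in> carrier G \<Longrightarrow> \<sigma> g \<in> carrier_mat m m"
      "\<And>g. g \<in> carrier G \<Longrightarrow> \<rho> g * P = P * \<sigma> g" by metis
  have "matrix_representation G m \<sigma>"
  proof (rule matrix_representationI[OF G])
    show "\<sigma> \<one>\<^bsub>G\<^esub> = 1\<^sub>m m"
    proof (rule injective_mat_cancel[OF P])
      show "P * \<sigma> \<one>\<^bsub>G\<^esub> = P * 1\<^sub>m m"
        using \<sigma>(2)[of "\<one>\<^bsub>G\<^esub>"] D(2) Pc by simp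
    qed (use \<sigma>(1) in auto)
    fix g h assume gh: "g \<in> carrier G" "h \<in> carrier G"
    show "\<sigma> (g \<otimes>\<^bsub>G\<^esub> h) = \<sigma> g * \<sigma> h"
    proof (rule injective_mat_cancel[OF P])
      have "P * \<sigma> (g \<otimes>\<^bsub>G\<^esub> h) = \<rho> g * \<rho> h * P"
        using \<sigma>(2)[of "g \<otimes>\<^bsub>G\<^esub> h"] D(3)[OF gh] gh by simp
      also have "\<dots> = \<rho> g * (P * \<sigma> h)"
        using assoc_mult_mat[OF D(1)[OF gh(1)] D(1)[OF gh(2)] Pc] \<sigma>(2)[OF gh(2)] by simp
      also have "\<dots> = \<rho> g * P * \<sigma> h"
        using assoc_mult_mat[OF D(1)[OF gh(1)] Pc \<sigma>(1)[OF gh(2)]] by simp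
      also have "\<dots> = P * (\<sigma> g * \<sigma> h)"
        using assoc_mult_mat[OF Pc \<sigma>(1)[OF gh(1)] \<sigma>(1)[OF gh(2)]] \<sigma>(2)[OF gh(1)] by simp
      finally show "P * \<sigma> (g \<otimes>\<^bsub>G\<^esub> h) = P * (\<sigma> g * \<sigma> h)" .
    next
      show "\<sigma> (g \<otimes>\<^bsub>G\<^esub> h) \<in> carrier_mat m m" using gh by (simp add: \<sigma>(1))
      show "\<sigma> g * \<sigma> h \<in> carrier_mat m m" using \<sigma>(1)[OF gh(1)] \<sigma>(1)[OF gh(2)] by simp
    qed
  qed (use \<sigma>(1) in auto)
  moreover have "\<forall>g\<in>carrier G. \<rho> g * P = P * \<sigma> g" using \<sigma>(2) by simp
  ultimately show ?thesis by (rule that)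
qed

lemma invariant_subspace_subrepresentation:
  assumes G: "group G" and rep: "matrix_representation G n \<rho>"
    and W: "linear_subspace n W" "W \<noteq> {0\<^sub>v n}"
    and inv: "\<And>g w. g \<in> carrier G \<Longrightarrow> w \<in> W \<Longrightarrow> \<rho> g *\<^sub>v w \<in> W"
  obtains m P \<sigma> where "0 < m" and "W \<noteq> carrier_vec n \<longrightarrow> m < n" and "injective_mat n m P"
    and "matrix_representation G m \<sigma>" and "\<forall>g\<in>carrier G. \<rho> g * P = P * \<sigma> g"
    and "\<forall>c\<in>carrier_vec m. P *\<^sub>v c \<in> W"
proof -
  obtain m P where P: "injective_mat n m P" and range: "W = (\<lambda>c. P *\<^sub>v c) ` carrier_vec m"
    by (rule linear_subspace_eq_range[OF W(1)])
  have Pc: "P \<in> carrier_mat n m" using P by (simp add: injective_mat_def)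
  have PW: "\<forall>c\<in>carrier_vec m. P *\<^sub>v c \<in> W" using range by simp
  have "\<rho> g *\<^sub>v (P *\<^sub>v c) \<in> (\<lambda>c. P *\<^sub>v c) ` carrier_vec m"
    if "g \<in> carrier G" "c \<in> carrier_vec m" for g c
    unfolding range[symmetric] using inv[OF that(1)] PW that(2) by simp
  then obtain \<sigma> where \<sigma>: "matrix_representation G m \<sigma>"
      "\<forall>g\<in>carrier G. \<rho> g * P = P * \<sigma> g"
    by (rule subrepresentation_on_invariant_subspace[OF G rep P])
  show ?thesis
  proof (rule that[OF _ _ P \<sigma> PW])
    show "0 < m"
    proof (rule ccontr)
      assume "\<not> 0 < m"
      then have "P *\<^sub>v c = 0\<^sub>v n" if "c \<in> carrier_vec m" for c
        using Pc that by (intro eq_vecI) (auto simp: scalar_prod_def)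
      then have "W \<subseteq> {0\<^sub>v n}" unfolding range by auto
      then show False using W by (auto simp: linear_subspace_def)
    qed
    show "W \<noteq> carrier_vec n \<longrightarrow> m < n"
    proof (intro impI, rule ccontr)
      assume proper: "W \<noteq> carrier_vec n"
      assume "\<not> m < n"
      then have "m = n" using injective_mat_le[OF P] by simp
      have "u \<in> W" if "u \<in> carrier_vec n" for u
        using injective_square_mat_surj[OF P[unfolded \<open>m = n\<close>] that] PW \<open>m = n\<close> by metis
      then show False using proper W(1) by (auto simp: linear_subspace_def)
    qed
  qed
qed

lemma compose_intertwiners:
  assumes rep: "\<And>g. g \<in> carrier G \<Longrightarrow> \<rho> g \<in> carrier_mat n n"
    "\<And>g. g \<in> carrier G \<Longrightarrow> \<sigma> g \<in> carrier_mat m m" "\<And>g. g \<in> carrier G \<Longrightarrow> \<pi> g \<in> carrier_mat k k"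
    and P: "P \<in> carrier_mat n m" and Q: "Q \<in> carrier_mat m k"
    and \<rho>\<sigma>: "\<forall>g\<in>carrier G. \<rho> g * P = P * \<sigma> g" and \<sigma>\<pi>: "\<forall>g\<in>carrier G. \<sigma> g * Q = Q * \<pi> g"
  shows "\<forall>g\<in>carrier G. \<rho> g * (P * Q) = P * Q * \<pi> g"
proof
  fix g assume g: "g \<in> carrier G"
  have "\<rho> g * (P * Q) = P * \<sigma> g * Q"
    using assoc_mult_mat[OF rep(1)[OF g] P Q] \<rho>\<sigma> g by simp
  also have "\<dots> = P * (Q * \<pi> g)"
    using assoc_mult_mat[OF P rep(2)[OF g] Q] \<sigma>\<pi> g by simp
  also have "\<dots> = P * Q * \<pi> g"
    using assoc_mult_mat[OF P Q rep(3)[OF g]] by simp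
  finally show "\<rho> g * (P * Q) = P * Q * \<pi> g" .
qed

text \<open>A representation that is not irreducible has a proper nonzero invariant subspace, on which the
  degree is smaller; descent on the degree ends at an irreducible representation.\<close>

lemma contains_irreducible:
  assumes G: "group G" and rep: "matrix_representation G n \<rho>" and "0 < n"
  obtains m P \<sigma> where "injective_mat n m P" and "irreducible_representation G m \<sigma>"
    and "\<forall>g\<in>carrier G. \<rho> g * P = P * \<sigma> g"
  using rep \<open>0 < n\<close>
proof (induction n arbitrary: \<rho> thesis rule: less_induct)
  case (less n)
  note D = matrix_representationD(1)[OF G]
  show ?case
  proof (cases "irreducible_representation G n \<rho>")
    case True
    have inj: "injective_mat n n (1\<^sub>m n)" by (simp add: injective_mat_def)
    have "\<rho> g * 1\<^sub>m n = 1\<^sub>m n * \<rho> g" if "g \<in> carrier G" for g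
      using left_mult_one_mat[OF D[OF less.prems(2) that]]
        right_mult_one_mat[OF D[OF less.prems(2) that]] by simp
    then have "\<forall>g\<in>carrier G. \<rho> g * 1\<^sub>m n = 1\<^sub>m n * \<rho> g" by blast
    then show ?thesis by (rule less.prems(1)[OF inj True])
  next
    case False
    then obtain W where W: "VectorSpace.subspace class_ring W (module_vec TYPE(complex) n)"
        "\<forall>g\<in>carrier G. \<forall>w\<in>W. \<rho> g *\<^sub>v w \<in> W" "W \<noteq> {0\<^sub>v n}" "W \<noteq> carrier_vec n"
      using less.prems(2,3) by (auto simp: irreducible_representation_def)
    have inv: "\<rho> g *\<^sub>v w \<in> W" if "g \<in> carrier G" "w \<in> W" for g w
      using W(2) that by simp
    obtain m P \<sigma> where 1: "0 < m" "W \<noteq> carrier_vec n \<longrightarrow> m < n" "injective_mat n m P"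
        "matrix_representation G m \<sigma>" "\<forall>g\<in>carrier G. \<rho> g * P = P * \<sigma> g"
      by (rule invariant_subspace_subrepresentation[OF G less.prems(2)
          linear_subspace_if_subspace[OF W(1)] W(3) inv])
    obtain k Q \<pi> where 2: "injective_mat m k Q" "irreducible_representation G k \<pi>"
        "\<forall>g\<in>carrier G. \<sigma> g * Q = Q * \<pi> g"
      by (rule less.IH[OF 1(2)[rule_format, OF W(4)] _ 1(4) 1(1)])
    have \<pi>: "matrix_representation G k \<pi>" using 2(2) by (simp add: irreducible_representation_def)
    have c: "P \<in> carrier_mat n m" "Q \<in> carrier_mat m k"
      using 1(3) 2(1) by (simp_all add: injective_mat_def)
    show ?thesis
      by (rule less.prems(1)[OF injective_mat_mult[OF 1(3) 2(1)] 2(2)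
          compose_intertwiners[OF D[OF less.prems(2)] D[OF 1(4)] D[OF \<pi>] c 1(5) 2(3)]])
  qed
qed

lemma invariant_subspace_contains_irreducible:
  assumes G: "group G" and rep: "matrix_representation G n \<rho>"
    and W: "linear_subspace n W" "W \<noteq> {0\<^sub>v n}"
    and inv: "\<And>g w. g \<in> carrier G \<Longrightarrow> w \<in> W \<Longrightarrow> \<rho> g *\<^sub>v w \<in> W"
  obtains m P \<sigma> where "injective_mat n m P" and "irreducible_representation G m \<sigma>"
    and "\<forall>g\<in>carrier G. \<rho> g * P = P * \<sigma> g"
    and "\<forall>c\<in>carrier_vec m. P *\<^sub>v c \<in> W"
proof -
  note D = matrix_representationD(1)[OF G]
  obtain m P \<sigma> where 1: "0 < m" "W \<noteq> carrier_vec n \<longrightarrow> m < n" "injective_mat n m P"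
      "matrix_representation G m \<sigma>" "\<forall>g\<in>carrier G. \<rho> g * P = P * \<sigma> g"
      "\<forall>c\<in>carrier_vec m. P *\<^sub>v c \<in> W"
    by (rule invariant_subspace_subrepresentation[OF G rep W inv])
  obtain k Q \<pi> where 2: "injective_mat m k Q" "irreducible_representation G k \<pi>"
      "\<forall>g\<in>carrier G. \<sigma> g * Q = Q * \<pi> g"
    by (rule contains_irreducible[OF G 1(4) 1(1)])
  have \<pi>: "matrix_representation G k \<pi>" using 2(2) by (simp add: irreducible_representation_def)
  have c: "P \<in> carrier_mat n m" "Q \<in> carrier_mat m k"
    using 1(3) 2(1) by (simp_all add: injective_mat_def)
  show ?thesis
  proof (rule that[OF injective_mat_mult[OF 1(3) 2(1)] 2(2)
        compose_intertwiners[OF D[OF rep] D[OF 1(4)] D[OF \<pi>] c 1(5) 2(3)]])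
    show "\<forall>v\<in>carrier_vec k. P * Q *\<^sub>v v \<in> W"
      using assoc_mult_mat_vec[OF c] 1(6) mult_mat_vec_carrier[OF c(2)] by simp
  qed
qed

text \<open>If the operator \<open>\<Sum>\<^sub>g a\<^sub>g \<rho> g\<close> is multiplication by \<open>k\<close> on the range of \<open>P\<close>, then
  \<open>\<Sum>\<^sub>g a\<^sub>g \<sigma> g\<close> is \<open>k\<close> times the identity matrix, and the claim is the equality of traces. Two cases
  matter later: the class function \<open>f\<close> acting by an eigenvalue, and the sum over a subgroup acting as zero.\<close>

lemma character_sum_if_scalar:
  assumes G: "group G" and rep: "matrix_representation G n \<rho>" "matrix_representation G m \<sigma>"
    and P: "injective_mat n m P" and inter: "\<forall>g\<in>carrier G. \<rho> g * P = P * \<sigma> g"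
    and A: "A \<subseteq> carrier G"
    and scalar: "\<And>c i. c \<in> carrier_vec m \<Longrightarrow> i < n \<Longrightarrow>
      (\<Sum>g\<in>A. a g * (\<rho> g *\<^sub>v (P *\<^sub>v c)) $ i) = k * (P *\<^sub>v c) $ i"
  shows "(\<Sum>g\<in>A. a g * character_of G m \<sigma> g) = k * of_nat m"
proof -
  have Pc: "P \<in> carrier_mat n m" using P by (simp add: injective_mat_def)
  note D\<rho> = matrix_representationD(1)[OF G rep(1)] and D\<sigma> = matrix_representationD(1)[OF G rep(2)]
  have diag: "(\<Sum>g\<in>A. a g * \<sigma> g $$ (j, j)) = k" if j: "j < m" for j
  proof -
    \<comment> \<open>The \<open>j\<close>-th column of \<open>\<Sum>\<^sub>g a\<^sub>g \<sigma> g\<close>.\<close>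
    define s where "s = vec m (\<lambda>l. \<Sum>g\<in>A. a g * \<sigma> g $$ (l, j))"
    have "P *\<^sub>v s = P *\<^sub>v (k \<cdot>\<^sub>v unit_vec m j)"
    proof (rule eq_vecI)
      fix i assume "i < dim_vec (P *\<^sub>v (k \<cdot>\<^sub>v unit_vec m j))"
      then have i: "i < n" using Pc by simp
      have "(P *\<^sub>v s) $ i = (\<Sum>l\<in>{0..<m}. \<Sum>g\<in>A. P $$ (i, l) * (a g * \<sigma> g $$ (l, j)))"
        using i Pc by (simp add: s_def scalar_prod_def sum_distrib_left)
      also have "\<dots> = (\<Sum>g\<in>A. a g * (\<Sum>l\<in>{0..<m}. P $$ (i, l) * \<sigma> g $$ (l, j)))"
        by (subst sum.swap) (simp add: sum_distrib_left mult_ac)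
      also have "\<dots> = (\<Sum>g\<in>A. a g * (\<rho> g *\<^sub>v (P *\<^sub>v unit_vec m j)) $ i)"
      proof (intro sum.cong refl arg_cong2[where f = "(*)"])
        fix g assume "g \<in> A"
        then have g: "g \<in> carrier G" using A by blast
        have "(\<Sum>l\<in>{0..<m}. P $$ (i, l) * \<sigma> g $$ (l, j)) = (P * \<sigma> g) $$ (i, j)"
          using Pc D\<sigma>[OF g] i j by (simp add: scalar_prod_def)
        also have "\<dots> = (\<rho> g * P) $$ (i, j)" using inter g by simp
        also have "\<dots> = (\<rho> g *\<^sub>v (P *\<^sub>v unit_vec m j)) $ i"
          using Pc D\<rho>[OF g] i j mat_mult_unit_vec[OF Pc j] by simp
        finally show "(\<Sum>l\<in>{0..<m}. P $$ (i, l) * \<sigma> g $$ (l, j)) =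
            (\<rho> g *\<^sub>v (P *\<^sub>v unit_vec m j)) $ i" .
      qed
      also have "\<dots> = k * (P *\<^sub>v unit_vec m j) $ i" by (rule scalar) (use i in auto)
      also have "\<dots> = (P *\<^sub>v (k \<cdot>\<^sub>v unit_vec m j)) $ i"
        using mult_mat_vec[OF Pc unit_vec_carrier[of m j], of k] i Pc by simp
      finally show "(P *\<^sub>v s) $ i = (P *\<^sub>v (k \<cdot>\<^sub>v unit_vec m j)) $ i" .
    qed simp
    then have "s = k \<cdot>\<^sub>v unit_vec m j"
      by (rule injective_mat_cancel_vec[OF P, rotated -1]) (simp_all add: s_def)
    then have "s $ j = (k \<cdot>\<^sub>v unit_vec m j) $ j" by simp
    then show ?thesis using j by (simp add: s_def)
  qed
  have "(\<Sum>g\<in>A. a g * character_of G m \<sigma> g) = (\<Sum>g\<in>A. \<Sum>j<m. a g * \<sigma> g $$ (j, j))"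
    using A by (intro sum.cong) (auto simp: character_of_def sum_distrib_left)
  also have "\<dots> = (\<Sum>j<m. k)"
    by (subst sum.swap) (simp add: diag)
  finally show ?thesis by simp
qed

section \<open>Canonical vectors and convolution with a class function\<close>

context group
begin

lemma bij_betw_mult_left: "g \<in> carrier G \<Longrightarrow> bij_betw (\<lambda>x. g \<otimes> x) (carrier G) (carrier G)"
  by (rule bij_betw_byWitness[where f' = "\<lambda>x. inv g \<otimes> x"]) (auto simp: m_assoc[symmetric])

lemma bij_betw_mult_right: "g \<in> carrier G \<Longrightarrow> bij_betw (\<lambda>x. x \<otimes> g) (carrier G) (carrier G)"
  by (rule bij_betw_byWitness[where f' = "\<lambda>x. x \<otimes> inv g"]) (auto simp: m_assoc)

lemma mult_left_eq_iff:
  assumes "g \<in> carrier G" "x \<in> carrier G" "y \<in> carrier G"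
  shows "x = g \<otimes> y \<longleftrightarrow> inv g \<otimes> x = y"
proof -
  have "y = inv g \<otimes> x \<longleftrightarrow> x = g \<otimes> y" by (rule inv_solve_left) fact+
  then show ?thesis by metis
qed

lemma bij_betw_conjugation:
  "g \<in> carrier G \<Longrightarrow> bij_betw (\<lambda>x. g \<otimes> x \<otimes> inv g) (carrier G) (carrier G)"
  using bij_betw_trans[OF bij_betw_mult_left bij_betw_mult_right[of "inv g"]] by (simp add: comp_def)

lemma bij_betw_inv_subgroup: "subgroup H G \<Longrightarrow> bij_betw (\<lambda>h. inv h) H H"
  by (rule bij_betw_byWitness[where f' = "\<lambda>h. inv h"])
    (auto simp: subgroup.m_inv_closed subgroup.mem_carrier)

lemma bij_betw_mult_inv: "x \<in> carrier G \<Longrightarrow> bij_betw (\<lambda>a. inv a \<otimes> x) (carrier G) (carrier G)"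
  using bij_betw_trans[OF bij_betw_inv_subgroup[OF subgroup_self] bij_betw_mult_right]
  by (simp add: comp_def)

text \<open>For the action on the left cosets of \<open>H\<close>, the elements that map \<open>a H\<close> to \<open>b H\<close> form the double
  translate \<open>b H (inv a)\<close>. The functions below are therefore those orthogonal to all canonical
  vectors, i.e. to the two-sided ideal of the group algebra generated by the sum of the elements of
  \<open>H\<close>. The sums over double
  translates have the advantage of making sense for real and complex functions alike.\<close>

definition vanishes_on_double_translates :: "'a set \<Rightarrow> ('a \<Rightarrow> 'f::comm_monoid_add) \<Rightarrow> bool" where
  "vanishes_on_double_translates H w \<longleftrightarrow>
     (\<forall>a\<in>carrier G. \<forall>b\<in>carrier G. (\<Sum>h\<in>H. w (b \<otimes> h \<otimes> a)) = 0)"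

text \<open>The matrix of \<open>f\<close> acts by convolution with \<open>f\<close>, i.e. by a combination of left translations.\<close>

lemma apply_on_class_function_matrix:
  assumes x: "x \<in> carrier G"
  shows "apply_on (carrier G) (class_function_matrix G f) w x =
    (\<Sum>a\<in>carrier G. f a * w (inv a \<otimes> x))"
proof -
  have "apply_on (carrier G) (class_function_matrix G f) w x =
      (\<Sum>y\<in>carrier G. f (x \<otimes> inv y) * w y)"
    by (simp add: apply_on_def class_function_matrix_def)
  also have "\<dots> = (\<Sum>a\<in>carrier G. f (x \<otimes> inv (inv a \<otimes> x)) * w (inv a \<otimes> x))"
    by (rule sum.reindex_bij_betw[OF bij_betw_mult_inv[OF x], symmetric])
  also have "\<dots> = (\<Sum>a\<in>carrier G. f a * w (inv a \<otimes> x))"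
    using x by (intro sum.cong refl) (simp add: inv_mult_group m_assoc[symmetric])
  finally show ?thesis .
qed

lemma class_function_matrix_symmetric:
  assumes "\<And>g. g \<in> carrier G \<Longrightarrow> f (inv g) = f g" and "i \<in> carrier G" and "j \<in> carrier G"
  shows "class_function_matrix G f i j = class_function_matrix G f j i"
proof -
  have "inv (i \<otimes> inv j) = j \<otimes> inv i" using assms(2,3) by (simp add: inv_mult_group)
  then show ?thesis
    using assms(1)[of "i \<otimes> inv j"] assms(2,3) by (simp add: class_function_matrix_def)
qed

lemma vanishes_class_function_matrix:
  assumes H: "H \<subseteq> carrier G" and w: "vanishes_on_double_translates H w"
  shows "vanishes_on_double_translates H (apply_on (carrier G) (class_function_matrix G f) w)"
  unfolding vanishes_on_double_translates_def
proof (intro ballI)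
  fix p q assume pq: "p \<in> carrier G" "q \<in> carrier G"
  have "(\<Sum>h\<in>H. apply_on (carrier G) (class_function_matrix G f) w (q \<otimes> h \<otimes> p)) =
      (\<Sum>h\<in>H. \<Sum>a\<in>carrier G. f a * w (inv a \<otimes> q \<otimes> h \<otimes> p))"
    using pq H by (intro sum.cong refl) (auto simp: apply_on_class_function_matrix m_assoc subset_iff)
  also have "\<dots> = (\<Sum>a\<in>carrier G. f a * (\<Sum>h\<in>H. w (inv a \<otimes> q \<otimes> h \<otimes> p)))"
    by (subst sum.swap) (simp add: sum_distrib_left)
  also have "\<dots> = 0"
    using w pq by (intro sum.neutral ballI) (simp add: vanishes_on_double_translates_def)
  finally show "(\<Sum>h\<in>H. apply_on (carrier G) (class_function_matrix G f) w (q \<otimes> h \<otimes> p)) = 0" .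
qed

text \<open>The constant function \<open>1\<close> is the sum of the canonical vectors that map \<open>H\<close> to the various left
  cosets. Equivalently, summing the defining relations over all left cosets \<open>x H\<close> with \<open>x \<in> G\<close> counts each
  value of \<open>w\<close> exactly \<open>card H\<close> times.\<close>

lemma vanishing_sum_eq_0:
  fixes w :: "'a \<Rightarrow> real"
  assumes fin: "finite (carrier G)" and H: "subgroup H G"
    and w: "vanishes_on_double_translates H w"
  shows "(\<Sum>x\<in>carrier G. w x) = 0"
proof -
  have HG: "H \<subseteq> carrier G" using H by (rule subgroup.subset)
  have "0 = (\<Sum>x\<in>carrier G. \<Sum>h\<in>H. w (x \<otimes> h))"
  proof (rule sum.neutral[symmetric], rule ballI)
    fix x assume x: "x \<in> carrier G"
    have "(\<Sum>h\<in>H. w (x \<otimes> h)) = (\<Sum>h\<in>H. w (x \<otimes> h \<otimes> \<one>))"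
      using x HG by (intro sum.cong refl) (simp add: subset_iff)
    also have "\<dots> = 0"
      using w x by (simp only: vanishes_on_double_translates_def one_closed)
    finally show "(\<Sum>h\<in>H. w (x \<otimes> h)) = 0" .
  qed
  also have "\<dots> = (\<Sum>h\<in>H. \<Sum>x\<in>carrier G. w (x \<otimes> h))" by (rule sum.swap)
  also have "\<dots> = (\<Sum>h\<in>H. \<Sum>x\<in>carrier G. w x)"
    using HG by (intro sum.cong refl sum.reindex_bij_betw[OF bij_betw_mult_right]) auto
  finally have "real (card H) * (\<Sum>x\<in>carrier G. w x) = 0" by simp
  moreover have "card H \<noteq> 0"
    using subgroup.one_closed[OF H] finite_subset[OF HG fin] by auto
  ultimately show ?thesis by simp
qed

lemma lcoset_action_maps_iff:
  assumes H: "subgroup H G" and t: "t \<in> carrier G" and a: "a \<in> carrier G" and b: "b \<in> carrier G"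
  shows "lcoset_action G H t (l_coset G a H) = l_coset G b H \<longleftrightarrow> (\<exists>h\<in>H. t = b \<otimes> h \<otimes> inv a)"
proof -
  have HG: "H \<subseteq> carrier G" using H by (rule subgroup.subset)
  have "l_coset G a H \<in> lcosets H" using a by (auto simp: LCOSETS_def)
  then have act: "lcoset_action G H t (l_coset G a H) = l_coset G (t \<otimes> a) H"
    using HG t a by (simp add: lcoset_action_def lcos_m_assoc)
  show ?thesis
    unfolding act
  proof
    assume "l_coset G (t \<otimes> a) H = l_coset G b H"
    moreover have "t \<otimes> a \<in> l_coset G (t \<otimes> a) H"
      using t a subgroup.one_closed[OF H] by (force simp: l_coset_def)
    ultimately obtain h where h: "h \<in> H" "t \<otimes> a = b \<otimes> h" by (auto simp: l_coset_def)
    then have "t = b \<otimes> h \<otimes> inv a"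
      using t a b HG inv_solve_right[of t "b \<otimes> h" a] by (auto simp: subset_iff)
    with h(1) show "\<exists>h\<in>H. t = b \<otimes> h \<otimes> inv a" by blast
  next
    assume "\<exists>h\<in>H. t = b \<otimes> h \<otimes> inv a"
    then obtain h where h: "h \<in> H" "t = b \<otimes> h \<otimes> inv a" by blast
    have hG: "h \<in> carrier G" using h(1) HG by blast
    have "t \<otimes> a = b \<otimes> h" using h(2) a b hG by (simp add: m_assoc)
    then have "l_coset G (t \<otimes> a) H = l_coset G b (l_coset G h H)"
      using lcos_m_assoc[OF HG b hG] by simp
    then show "l_coset G (t \<otimes> a) H = l_coset G b H"
      using coset_join3[OF hG H h(1)] by simp
  qed
qed

lemma inner_on_canonical:
  assumes fin: "finite (carrier G)" and H: "subgroup H G"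
    and a: "a \<in> carrier G" and b: "b \<in> carrier G"
  shows "inner_on (carrier G) w
      (indicator {t \<in> carrier G. lcoset_action G H t (l_coset G a H) = l_coset G b H}) =
    (\<Sum>h\<in>H. w (b \<otimes> h \<otimes> inv a))"
proof -
  have HG: "H \<subseteq> carrier G" using H by (rule subgroup.subset)
  have eq: "{t \<in> carrier G. lcoset_action G H t (l_coset G a H) = l_coset G b H} =
      (\<lambda>h. b \<otimes> h \<otimes> inv a) ` H"
  proof -
    have "{t \<in> carrier G. lcoset_action G H t (l_coset G a H) = l_coset G b H} =
        {t \<in> carrier G. \<exists>h\<in>H. t = b \<otimes> h \<otimes> inv a}"
      by (rule Collect_cong) (simp add: lcoset_action_maps_iff[OF H _ a b] cong: conj_cong)
    also have "\<dots> = (\<lambda>h. b \<otimes> h \<otimes> inv a) ` H" using a b HG by auto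
    finally show ?thesis .
  qed
  have inj: "inj_on (\<lambda>h. b \<otimes> h \<otimes> inv a) H"
    using a b HG by (intro inj_onI) (simp add: subset_iff)
  have "inner_on (carrier G) w (indicator ((\<lambda>h. b \<otimes> h \<otimes> inv a) ` H)) =
      (\<Sum>t\<in>carrier G \<inter> (\<lambda>h. b \<otimes> h \<otimes> inv a) ` H. w t)"
    using fin by (simp add: inner_on_def indicator_def sum.inter_restrict if_distrib cong: if_cong)
  also have "carrier G \<inter> (\<lambda>h. b \<otimes> h \<otimes> inv a) ` H = (\<lambda>h. b \<otimes> h \<otimes> inv a) ` H"
    using a b HG by auto
  also have "(\<Sum>t\<in>(\<lambda>h. b \<otimes> h \<otimes> inv a) ` H. w t) = (\<Sum>h\<in>H. w (b \<otimes> h \<otimes> inv a))"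
    by (simp add: sum.reindex[OF inj])
  finally show ?thesis by (simp add: eq)
qed

lemma vanishes_iff_orthogonal_to_canonical:
  assumes fin: "finite (carrier G)" and H: "subgroup H G"
  shows "vanishes_on_double_translates H w \<longleftrightarrow>
    (\<forall>\<alpha>\<in>lcosets H. \<forall>\<beta>\<in>lcosets H.
      inner_on (carrier G) w (indicator {t \<in> carrier G. lcoset_action G H t \<alpha> = \<beta>}) = 0)"
proof
  assume w: "vanishes_on_double_translates H w"
  show "\<forall>\<alpha>\<in>lcosets H. \<forall>\<beta>\<in>lcosets H.
      inner_on (carrier G) w (indicator {t \<in> carrier G. lcoset_action G H t \<alpha> = \<beta>}) = 0"
  proof (intro ballI)
    fix \<alpha> \<beta> assume "\<alpha> \<in> lcosets H" "\<beta> \<in> lcosets H"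
    then obtain a b where ab: "a \<in> carrier G" "b \<in> carrier G" "\<alpha> = l_coset G a H" "\<beta> = l_coset G b H"
      by (auto simp: LCOSETS_def)
    then show "inner_on (carrier G) w (indicator {t \<in> carrier G. lcoset_action G H t \<alpha> = \<beta>}) = 0"
      using w inner_on_canonical[OF fin H ab(1,2)] by (simp add: vanishes_on_double_translates_def)
  qed
next
  assume orth: "\<forall>\<alpha>\<in>lcosets H. \<forall>\<beta>\<in>lcosets H.
      inner_on (carrier G) w (indicator {t \<in> carrier G. lcoset_action G H t \<alpha> = \<beta>}) = 0"
  show "vanishes_on_double_translates H w"
    unfolding vanishes_on_double_translates_def
  proof (intro ballI)
    fix a b assume ab: "a \<in> carrier G" "b \<in> carrier G"
    then have "l_coset G (inv a) H \<in> lcosets H" "l_coset G b H \<in> lcosets H"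
      by (auto simp: LCOSETS_def)
    then show "(\<Sum>h\<in>H. w (b \<otimes> h \<otimes> a)) = 0"
      using orth inner_on_canonical[OF fin H inv_closed[OF ab(1)] ab(2), of w] ab by simp
  qed
qed

lemma finite_lcosets: "finite (carrier G) \<Longrightarrow> finite (lcosets H)"
  by (simp add: LCOSETS_def)

section \<open>Eigenfunctions orthogonal to the canonical vectors\<close>

text \<open>The left regular representation, written as permutation matrices with respect to an enumeration \<open>e\<close>
  of the group.\<close>

definition regular_representation :: "(nat \<Rightarrow> 'a) \<Rightarrow> 'a \<Rightarrow> complex mat" where
  "regular_representation e g =
     mat (card (carrier G)) (card (carrier G)) (\<lambda>(i, j). if e i = g \<otimes> e j then 1 else 0)"

text \<open>The function on the group that has the given coordinates with respect to the enumeration \<open>e\<close>; on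
  functions, \<open>g\<close> acts by \<open>w \<mapsto> (x \<mapsto> w (inv g \<otimes> x))\<close>.\<close>

definition fun_of_vec :: "(nat \<Rightarrow> 'a) \<Rightarrow> complex vec \<Rightarrow> 'a \<Rightarrow> complex" where
  "fun_of_vec e v x = v $ inv_into {0..<card (carrier G)} e x"

lemma regular_representation_apply:
  assumes e: "bij_betw e {0..<card (carrier G)} (carrier G)" and g: "g \<in> carrier G"
    and v: "v \<in> carrier_vec (card (carrier G))" and i: "i < card (carrier G)"
  shows "(regular_representation e g *\<^sub>v v) $ i = fun_of_vec e v (inv g \<otimes> e i)"
proof -
  let ?k = "inv_into {0..<card (carrier G)} e (inv g \<otimes> e i)"
  have eG: "e j \<in> carrier G" if "j < card (carrier G)" for j
    using bij_betwE[OF e] that by auto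
  have x: "inv g \<otimes> e i \<in> carrier G" using g eG[OF i] by simp
  have k: "?k < card (carrier G)" using bij_betw_apply[OF bij_betw_inv_into[OF e] x] by simp
  have iff: "e i = g \<otimes> e j \<longleftrightarrow> j = ?k" if j: "j < card (carrier G)" for j
  proof -
    have "e i = g \<otimes> e j \<longleftrightarrow> inv g \<otimes> e i = e j"
      by (rule mult_left_eq_iff[OF g eG[OF i] eG[OF j]])
    also have "\<dots> \<longleftrightarrow> j = ?k"
    proof
      show "j = ?k" if "inv g \<otimes> e i = e j"
        unfolding that using bij_betw_inv_into_left[OF e, of j] j by simp
      show "inv g \<otimes> e i = e j" if "j = ?k"
        unfolding that using bij_betw_inv_into_right[OF e x] by simp
    qed
    finally show ?thesis .
  qed
  have "(regular_representation e g *\<^sub>v v) $ i =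
      (\<Sum>j\<in>{0..<card (carrier G)}. (if e i = g \<otimes> e j then 1 else 0) * v $ j)"
    using v i by (simp add: regular_representation_def scalar_prod_def)
  also have "\<dots> = (\<Sum>j\<in>{0..<card (carrier G)}. if j = ?k then v $ j else 0)"
    by (intro sum.cong refl) (simp add: iff)
  also have "\<dots> = v $ ?k" using k by (simp add: sum.delta)
  finally show ?thesis by (simp add: fun_of_vec_def)
qed

lemma fun_of_vec_regular_representation:
  assumes e: "bij_betw e {0..<card (carrier G)} (carrier G)" and g: "g \<in> carrier G"
    and v: "v \<in> carrier_vec (card (carrier G))" and x: "x \<in> carrier G"
  shows "fun_of_vec e (regular_representation e g *\<^sub>v v) x = fun_of_vec e v (inv g \<otimes> x)"
proof -
  have "inv_into {0..<card (carrier G)} e x < card (carrier G)"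
    using bij_betw_apply[OF bij_betw_inv_into[OF e] x] by simp
  then show ?thesis
    using regular_representation_apply[OF e g v] bij_betw_inv_into_right[OF e x]
    by (simp add: fun_of_vec_def[of e "_ *\<^sub>v _"])
qed

lemma matrix_representation_regular:
  assumes e: "bij_betw e {0..<card (carrier G)} (carrier G)"
  shows "matrix_representation G (card (carrier G)) (regular_representation e)"
proof (rule matrix_representationI[OF group_axioms])
  have eG: "e j \<in> carrier G" if "j < card (carrier G)" for j
    using bij_betwE[OF e] that by auto
  have inj: "e i = e j \<longleftrightarrow> i = j" if "i < card (carrier G)" "j < card (carrier G)" for i j
    using bij_betw_imp_inj_on[OF e] that by (auto simp: inj_on_def)
  show "regular_representation e \<one> = 1\<^sub>m (card (carrier G))"
    by (intro eq_matI) (auto simp: regular_representation_def eG inj)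
  show carr: "regular_representation e g \<in> carrier_mat (card (carrier G)) (card (carrier G))" for g
    by (simp add: regular_representation_def)
  fix g h assume g: "g \<in> carrier G" and h: "h \<in> carrier G"
  show "regular_representation e (g \<otimes> h) = regular_representation e g * regular_representation e h"
  proof (rule eq_matI)
    fix i j assume "i < dim_row (regular_representation e g * regular_representation e h)"
      "j < dim_col (regular_representation e g * regular_representation e h)"
    then have ij: "i < card (carrier G)" "j < card (carrier G)" by (simp_all add: regular_representation_def)
    let ?k = "inv_into {0..<card (carrier G)} e (inv g \<otimes> e i)"
    have x: "inv g \<otimes> e i \<in> carrier G" using g eG[OF ij(1)] by simp
    have k: "?k < card (carrier G)" "e ?k = inv g \<otimes> e i"
      using bij_betw_apply[OF bij_betw_inv_into[OF e] x] bij_betw_inv_into_right[OF e x] by simp_all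
    have c: "col (regular_representation e h) j \<in> carrier_vec (card (carrier G))"
      by (rule carrier_vecI) (simp only: dim_col carrier_matD(1)[OF carr])
    have "(regular_representation e g * regular_representation e h) $$ (i, j) =
        (regular_representation e g *\<^sub>v col (regular_representation e h) j) $ i"
      using ij carrier_matD[OF carr[of g]] carrier_matD[OF carr[of h]]
      by (simp only: index_mult_mat(1) index_mult_mat_vec)
    also have "\<dots> = col (regular_representation e h) j $ ?k"
      using regular_representation_apply[OF e g c ij(1)] by (simp add: fun_of_vec_def)
    also have "\<dots> = (if inv g \<otimes> e i = h \<otimes> e j then 1 else 0)"
      using k ij by (simp add: regular_representation_def)
    also have "inv g \<otimes> e i = h \<otimes> e j \<longleftrightarrow> e i = g \<otimes> h \<otimes> e j"
      using mult_left_eq_iff[OF g eG[OF ij(1)], of "h \<otimes> e j"] g h eG[OF ij(2)]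
      by (simp add: m_assoc)
    also have "(if e i = g \<otimes> h \<otimes> e j then 1 else 0) = regular_representation e (g \<otimes> h) $$ (i, j)"
      using ij by (simp add: regular_representation_def)
    finally show "regular_representation e (g \<otimes> h) $$ (i, j) =
        (regular_representation e g * regular_representation e h) $$ (i, j)" by simp
  qed (simp_all add: regular_representation_def)
qed

text \<open>Being constant on conjugacy classes, \<open>f\<close> is central in the group algebra, so convolution with \<open>f\<close>
  commutes with left translation and its eigenspaces are invariant under the regular representation.\<close>

lemma eigenfunction_translate:
  fixes f :: "'a \<Rightarrow> real" and w :: "'a \<Rightarrow> complex"
  assumes f: "class_function G f" and g: "g \<in> carrier G" and x: "x \<in> carrier G"
    and eig: "\<And>x. x \<in> carrier G \<Longrightarrow> (\<Sum>a\<in>carrier G. of_real (f a) * w (inv a \<otimes> x)) = k * w x"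
  shows "(\<Sum>a\<in>carrier G. of_real (f a) * w (inv g \<otimes> (inv a \<otimes> x))) = k * w (inv g \<otimes> x)"
proof -
  have "(\<Sum>a\<in>carrier G. of_real (f a) * w (inv g \<otimes> (inv a \<otimes> x))) =
      (\<Sum>a\<in>carrier G. of_real (f (g \<otimes> a \<otimes> inv g)) * w (inv g \<otimes> (inv (g \<otimes> a \<otimes> inv g) \<otimes> x)))"
    by (rule sum.reindex_bij_betw[OF bij_betw_conjugation[OF g], symmetric])
  also have "\<dots> = (\<Sum>a\<in>carrier G. of_real (f a) * w (inv a \<otimes> (inv g \<otimes> x)))"
  proof (intro sum.cong refl arg_cong2[where f = "(*)"] arg_cong[where f = w])
    fix a assume a: "a \<in> carrier G"
    show "complex_of_real (f (g \<otimes> a \<otimes> inv g)) = complex_of_real (f a)"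
      using f a g by (simp add: class_function_def)
    have "inv g \<otimes> (g \<otimes> y) = y" if "y \<in> carrier G" for y
      using that g by (simp flip: m_assoc)
    then show "inv g \<otimes> (inv (g \<otimes> a \<otimes> inv g) \<otimes> x) = inv a \<otimes> (inv g \<otimes> x)"
      using a g x by (simp add: inv_mult_group m_assoc)
  qed
  also have "\<dots> = k * w (inv g \<otimes> x)" using eig[of "inv g \<otimes> x"] g x by simp
  finally show ?thesis .
qed

text \<open>Here the condition on characters enters. The functions \<open>w\<close> with these two properties form an
  invariant subspace of the regular representation. If it is nonzero, it contains an irreducible
  subrepresentation, with character \<open>\<chi>\<close> say. On it \<open>f\<close> acts as the scalar \<open>k\<close>, and taking traces
  shows that \<open>\<chi>\<close> is one of the characters with \<open>f\<close>-eigenvalue \<open>k\<close>. But the sum over \<open>H\<close> acts on it as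
  zero, since its value at \<open>x\<close> is the sum of \<open>w\<close> over \<open>H x\<close>; so the sum of \<open>\<chi>\<close> over \<open>H\<close> vanishes,
  against the hypothesis.\<close>

lemma vanishing_eigenfunction_eq_0:
  fixes f :: "'a \<Rightarrow> real" and w :: "'a \<Rightarrow> complex"
  assumes fin: "finite (carrier G)" and H: "subgroup H G" and f: "class_function G f"
    and irr: "\<And>\<chi>. \<chi> \<in> Irr G \<Longrightarrow>
      1 / \<chi> \<one> * (\<Sum>g\<in>carrier G. complex_of_real (f g) * \<chi> g) = k \<Longrightarrow> character_sum \<chi> H \<noteq> 0"
    and van: "vanishes_on_double_translates H w"
    and eig: "\<And>x. x \<in> carrier G \<Longrightarrow> (\<Sum>a\<in>carrier G. of_real (f a) * w (inv a \<otimes> x)) = k * w x"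
    and x: "x \<in> carrier G"
  shows "w x = 0"
proof (rule ccontr)
  assume wx: "w x \<noteq> 0"
  define N where "N = card (carrier G)"
  have HG: "H \<subseteq> carrier G" using H by (rule subgroup.subset)
  obtain e where e: "bij_betw e {0..<N} (carrier G)"
    using ex_bij_betw_nat_finite[OF fin] by (auto simp: N_def)
  define \<rho> where "\<rho> = regular_representation e"
  define fn where "fn = fun_of_vec e"
  have rep: "matrix_representation G N \<rho>"
    using matrix_representation_regular e by (simp add: N_def \<rho>_def)
  have apply_\<rho>: "(\<rho> g *\<^sub>v v) $ i = fn v (inv g \<otimes> e i)"
    if "g \<in> carrier G" "v \<in> carrier_vec N" "i < N" for g v i
    using regular_representation_apply e that by (simp add: N_def \<rho>_def fn_def)
  have fn_\<rho>: "fn (\<rho> g *\<^sub>v v) y = fn v (inv g \<otimes> y)"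
    if "g \<in> carrier G" "v \<in> carrier_vec N" "y \<in> carrier G" for g v y
    using fun_of_vec_regular_representation e that by (simp add: N_def \<rho>_def fn_def)
  have idx: "inv_into {0..<N} e y < N" if "y \<in> carrier G" for y
    using bij_betw_apply[OF bij_betw_inv_into[OF e] that] by simp
  have eG: "e i \<in> carrier G" if "i < N" for i
    using bij_betwE[OF e] that by auto
  have fn_e: "fn v (e i) = v $ i" if "i < N" for v i
    using bij_betw_inv_into_left[OF e, of i] that by (simp add: fn_def fun_of_vec_def N_def)
  have fn_zero: "fn (0\<^sub>v N) y = 0" if "y \<in> carrier G" for y
    using idx[OF that] by (simp add: fn_def fun_of_vec_def N_def)
  have fn_smult: "fn (c \<cdot>\<^sub>v u) y = c * fn u y" if "y \<in> carrier G" "u \<in> carrier_vec N" for c u y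
    using idx[OF that(1)] that(2) by (simp add: fn_def fun_of_vec_def N_def)
  have fn_add: "fn (u + v) y = fn u y + fn v y"
    if "y \<in> carrier G" "u \<in> carrier_vec N" "v \<in> carrier_vec N" for u v y
    using idx[OF that(1)] that(2,3) by (simp add: fn_def fun_of_vec_def N_def)
  define W where "W = {v \<in> carrier_vec N. vanishes_on_double_translates H (fn v) \<and>
    (\<forall>y\<in>carrier G. (\<Sum>a\<in>carrier G. of_real (f a) * fn v (inv a \<otimes> y)) = k * fn v y)}"
  have closed: "b \<otimes> h \<otimes> a \<in> carrier G" if "h \<in> H" "a \<in> carrier G" "b \<in> carrier G" for a b h
    using that HG by auto
  have subspace: "linear_subspace N W"
    unfolding linear_subspace_def
  proof (intro conjI ballI allI)
    show "W \<subseteq> carrier_vec N" by (auto simp: W_def)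
    show "0\<^sub>v N \<in> W"
      using closed by (simp add: W_def vanishes_on_double_translates_def fn_zero)
    show "u + v \<in> W" if "u \<in> W" "v \<in> W" for u v
      using that closed
      by (simp add: W_def vanishes_on_double_translates_def fn_add sum.distrib distrib_left)
    show "c \<cdot>\<^sub>v u \<in> W" if "u \<in> W" for c u
    proof -
      have "u \<in> carrier_vec N" using that by (simp add: W_def)
      then show ?thesis
        using that closed
        by (simp add: W_def vanishes_on_double_translates_def fn_smult
            sum_distrib_left[symmetric] mult.left_commute)
    qed
  qed
  have nonzero: "W \<noteq> {0\<^sub>v N}"
  proof -
    define v where "v = vec N (\<lambda>i. w (e i))"
    have fn_v: "fn v y = w y" if "y \<in> carrier G" for y
      using idx[OF that] bij_betw_inv_into_right[OF e that]
      by (simp add: fn_def fun_of_vec_def v_def N_def)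
    have "v \<in> carrier_vec N" by (simp add: v_def)
    moreover have "vanishes_on_double_translates H (fn v)"
      using van closed by (simp add: vanishes_on_double_translates_def fn_v)
    moreover have "\<forall>y\<in>carrier G.
        (\<Sum>a\<in>carrier G. of_real (f a) * fn v (inv a \<otimes> y)) = k * fn v y"
      using eig by (simp add: fn_v)
    ultimately have "v \<in> W" by (simp only: W_def mem_Collect_eq simp_thms)
    moreover have "v \<noteq> 0\<^sub>v N"
      using wx fn_v[OF x] fn_zero[OF x] by metis
    ultimately show ?thesis by blast
  qed
  have invariant: "\<rho> g *\<^sub>v v \<in> W" if g: "g \<in> carrier G" and v: "v \<in> W" for g v
  proof -
    have vc: "v \<in> carrier_vec N" and vv: "vanishes_on_double_translates H (fn v)"
      and ve: "\<And>y. y \<in> carrier G \<Longrightarrow> (\<Sum>a\<in>carrier G. of_real (f a) * fn v (inv a \<otimes> y)) = k * fn v y"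
      using v by (auto simp: W_def)
    have "vanishes_on_double_translates H (fn (\<rho> g *\<^sub>v v))"
      unfolding vanishes_on_double_translates_def
    proof (intro ballI)
      fix a b assume ab: "a \<in> carrier G" "b \<in> carrier G"
      have "(\<Sum>h\<in>H. fn (\<rho> g *\<^sub>v v) (b \<otimes> h \<otimes> a)) = (\<Sum>h\<in>H. fn v (inv g \<otimes> b \<otimes> h \<otimes> a))"
      proof (intro sum.cong refl)
        fix h assume h: "h \<in> H"
        show "fn (\<rho> g *\<^sub>v v) (b \<otimes> h \<otimes> a) = fn v (inv g \<otimes> b \<otimes> h \<otimes> a)"
          using fn_\<rho>[OF g vc closed[OF h ab]] g ab h HG by (simp add: m_assoc subset_iff)
      qed
      also have "\<dots> = 0" using vv g ab by (simp add: vanishes_on_double_translates_def)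
      finally show "(\<Sum>h\<in>H. fn (\<rho> g *\<^sub>v v) (b \<otimes> h \<otimes> a)) = 0" .
    qed
    moreover have "(\<Sum>a\<in>carrier G. of_real (f a) * fn (\<rho> g *\<^sub>v v) (inv a \<otimes> y)) =
        k * fn (\<rho> g *\<^sub>v v) y" if y: "y \<in> carrier G" for y
      using eigenfunction_translate[OF f g y ve] y by (simp add: fn_\<rho>[OF g vc])
    moreover have "\<rho> g *\<^sub>v v \<in> carrier_vec N"
      using matrix_representationD(1)[OF group_axioms rep g] vc by simp
    ultimately show ?thesis by (simp add: W_def)
  qed
  obtain m P \<sigma> where P: "injective_mat N m P" and irr_\<sigma>: "irreducible_representation G m \<sigma>"
    and inter: "\<forall>g\<in>carrier G. \<rho> g * P = P * \<sigma> g" and PW: "\<forall>c\<in>carrier_vec m. P *\<^sub>v c \<in> W"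
    by (rule invariant_subspace_contains_irreducible[OF group_axioms rep subspace nonzero invariant])
  have \<sigma>: "matrix_representation G m \<sigma>" and m: "0 < m"
    using irr_\<sigma> by (auto simp: irreducible_representation_def)
  define \<chi> where "\<chi> = character_of G m \<sigma>"
  have \<chi>_Irr: "\<chi> \<in> Irr G" using irr_\<sigma> by (auto simp: Irr_def \<chi>_def)
  have \<chi>_one: "\<chi> \<one> = of_nat m"
    using matrix_representationD(2)[OF group_axioms \<sigma>] by (simp add: \<chi>_def character_of_def)
  have "(\<Sum>g\<in>carrier G. complex_of_real (f g) * character_of G m \<sigma> g) = k * of_nat m"
  proof (rule character_sum_if_scalar[OF group_axioms rep \<sigma> P inter subset_refl])
    fix c :: "complex vec" and i assume c: "c \<in> carrier_vec m" and i: "i < N"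
    have Pc: "P *\<^sub>v c \<in> W" using PW c by simp
    then have cv: "P *\<^sub>v c \<in> carrier_vec N" by (simp add: W_def)
    have "(\<Sum>g\<in>carrier G. complex_of_real (f g) * (\<rho> g *\<^sub>v (P *\<^sub>v c)) $ i) =
        (\<Sum>g\<in>carrier G. complex_of_real (f g) * fn (P *\<^sub>v c) (inv g \<otimes> e i))"
      by (intro sum.cong refl) (simp add: apply_\<rho>[OF _ cv i])
    also have "\<dots> = k * fn (P *\<^sub>v c) (e i)" using Pc eG[OF i] by (simp add: W_def)
    finally show "(\<Sum>g\<in>carrier G. complex_of_real (f g) * (\<rho> g *\<^sub>v (P *\<^sub>v c)) $ i) =
        k * (P *\<^sub>v c) $ i" by (simp add: fn_e[OF i])
  qed
  then have "1 / \<chi> \<one> * (\<Sum>g\<in>carrier G. complex_of_real (f g) * \<chi> g) = k"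
    using m by (simp add: \<chi>_one flip: \<chi>_def)
  then have "character_sum \<chi> H \<noteq> 0" by (rule irr[OF \<chi>_Irr])
  moreover have "(\<Sum>h\<in>H. 1 * character_of G m \<sigma> h) = 0 * of_nat m"
  proof (rule character_sum_if_scalar[OF group_axioms rep \<sigma> P inter HG])
    fix c :: "complex vec" and i assume c: "c \<in> carrier_vec m" and i: "i < N"
    have Pc: "P *\<^sub>v c \<in> W" using PW c by simp
    then have cv: "P *\<^sub>v c \<in> carrier_vec N" by (simp add: W_def)
    have "(\<Sum>h\<in>H. 1 * (\<rho> h *\<^sub>v (P *\<^sub>v c)) $ i) = (\<Sum>h\<in>H. fn (P *\<^sub>v c) (inv h \<otimes> e i))"
      using HG by (intro sum.cong refl) (simp add: apply_\<rho>[OF _ cv i] subset_iff)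
    also have "\<dots> = (\<Sum>h\<in>H. fn (P *\<^sub>v c) (h \<otimes> e i))"
      by (rule sum.reindex_bij_betw[OF bij_betw_inv_subgroup[OF H]])
    also have "\<dots> = (\<Sum>h\<in>H. fn (P *\<^sub>v c) (\<one> \<otimes> h \<otimes> e i))"
      using HG by (intro sum.cong refl) (simp add: subset_iff)
    also have "\<dots> = 0"
      using Pc eG[OF i] by (simp add: W_def vanishes_on_double_translates_def del: l_one)
    finally show "(\<Sum>h\<in>H. 1 * (\<rho> h *\<^sub>v (P *\<^sub>v c)) $ i) = 0 * (P *\<^sub>v c) $ i" by simp
  qed
  then have "character_sum \<chi> H = 0" by (simp add: character_sum_def \<chi>_def)
  ultimately show False by contradiction
qed

text \<open>Write \<open>v = a + b\<close> with \<open>a\<close> in the span \<open>J\<close> of the canonical vectors and \<open>b\<close> orthogonal to it. Both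
  \<open>J\<close> and its orthogonal complement are stable under convolution with \<open>f\<close>, and \<open>J\<close> contains the
  constants. Hence \<open>z = M b - k b = c - (M a - k a)\<close> lies in both and is zero. So \<open>b\<close> is an
  eigenfunction orthogonal to \<open>J\<close>, and \<open>b = 0\<close> by the previous lemma.\<close>

lemma in_canonical_span_if_shifted_eigenvector:
  fixes f :: "'a \<Rightarrow> real" and v :: "'a \<Rightarrow> real"
  assumes fin: "finite (carrier G)" and H: "subgroup H G" and f: "class_function G f"
    and irr: "\<And>\<chi>. \<chi> \<in> Irr G \<Longrightarrow>
      1 / \<chi> \<one> * (\<Sum>g\<in>carrier G. complex_of_real (f g) * \<chi> g) = complex_of_real k \<Longrightarrow>
      character_sum \<chi> H \<noteq> 0"
    and sym: "\<And>g. g \<in> carrier G \<Longrightarrow> f (inv g) = f g"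
    and v: "\<And>x. x \<in> carrier G \<Longrightarrow>
      apply_on (carrier G) (class_function_matrix G f) v x = k * v x + c"
  shows "\<exists>C. \<forall>x\<in>carrier G. v x = (\<Sum>\<alpha>\<in>lcosets H. \<Sum>\<beta>\<in>lcosets H.
    C \<alpha> \<beta> * indicator {t \<in> carrier G. lcoset_action G H t \<alpha> = \<beta>} x)"
proof -
  define I where "I = carrier G"
  define M where "M = class_function_matrix G f"
  define u where "u = (\<lambda>p. (indicator {t \<in> carrier G. lcoset_action G H t (fst p) = snd p}) :: 'a \<Rightarrow> real)"
  define K where "K = (lcosets H) \<times> (lcosets H)"
  have finK: "finite K" using finite_lcosets[OF fin] by (simp add: K_def)
  have van_iff: "vanishes_on_double_translates H w \<longleftrightarrow> (\<forall>l\<in>K. inner_on I w (u l) = 0)" for w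
    using vanishes_iff_orthogonal_to_canonical[OF fin H, of w] by (auto simp: K_def u_def I_def)
  obtain C where C: "\<forall>l\<in>K. inner_on I (\<lambda>x. v x - (\<Sum>l\<in>K. C l * u l x)) (u l) = 0"
    using orthogonal_decomposition[OF _ finK, of I v u] fin by (auto simp: I_def)
  define a where "a = (\<lambda>x. \<Sum>l\<in>K. C l * u l x)"
  define b where "b = (\<lambda>x. v x - a x)"
  define z where "z = (\<lambda>x. apply_on I M b x - k * b x)"
  have b: "vanishes_on_double_translates H b" using C by (simp add: van_iff b_def a_def)
  note van_M = vanishes_class_function_matrix[OF subgroup.subset[OF H], of _ f,
      folded I_def M_def]
  have z: "vanishes_on_double_translates H z"
    using b van_M[OF b] by (simp add: van_iff z_def inner_on_linear)
  have perp_a: "inner_on I w a = 0" if "vanishes_on_double_translates H w" for w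
    using that by (simp add: a_def inner_on_sum_right van_iff)
  have M_sym: "M i j = M j i" if "i \<in> I" "j \<in> I" for i j
    using class_function_matrix_symmetric[where f = f, OF sym] that by (simp add: M_def I_def)
  have z_alt: "z x = c - (apply_on I M a x - k * a x)" if "x \<in> I" for x
    using v that by (simp add: z_def b_def apply_on_diff I_def M_def algebra_simps)
  have "inner_on I z z = inner_on I z (\<lambda>x. c * 1 - (apply_on I M a x - k * a x))"
    unfolding inner_on_def by (intro sum.cong refl) (simp add: z_alt)
  also have "\<dots> = c * inner_on I z (\<lambda>x. 1) - (inner_on I z (apply_on I M a) - k * inner_on I z a)"
    by (simp only: inner_on_linear)
  also have "inner_on I z (\<lambda>x. 1) = 0"
    using vanishing_sum_eq_0[OF fin H z] by (simp add: inner_on_def I_def)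
  also have "inner_on I z (apply_on I M a) = 0"
    using inner_on_apply_on_symmetric[of I M z a] M_sym perp_a[OF van_M[OF z]] by simp
  also have "inner_on I z a = 0" by (rule perp_a[OF z])
  finally have z0: "z x = 0" if "x \<in> I" for x
    using inner_on_self_eq_0[of I z] fin that by (simp add: I_def)
  have "complex_of_real (b x) = 0" if x: "x \<in> carrier G" for x
  proof (rule vanishing_eigenfunction_eq_0[OF fin H f irr, where w = "\<lambda>x. complex_of_real (b x)"])
    show "vanishes_on_double_translates H (\<lambda>x. complex_of_real (b x))"
      using b by (simp add: vanishes_on_double_translates_def flip: of_real_sum)
    fix y assume y: "y \<in> carrier G"
    have "(\<Sum>a\<in>carrier G. f a * b (inv a \<otimes> y)) = k * b y"
      using z0[of y] y apply_on_class_function_matrix[OF y, of f b]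
      by (simp add: z_def I_def M_def)
    then show "(\<Sum>a\<in>carrier G. complex_of_real (f a) * complex_of_real (b (inv a \<otimes> y))) =
        complex_of_real k * complex_of_real (b y)"
      by (simp flip: of_real_mult of_real_sum)
  qed (use x in auto)
  then have "v x = a x" if "x \<in> carrier G" for x using that by (simp add: b_def)
  then show ?thesis
    by (intro exI[of _ "\<lambda>\<alpha> \<beta>. C (\<alpha>, \<beta>)"])
      (simp add: a_def K_def u_def sum.cartesian_product case_prod_unfold)
qed

end

section \<open>The ratio bound\<close>

lemma (in group_action) compatible_class_function_inv:
  assumes f: "compatible_class_function G E \<phi> f" and g: "g \<in> carrier G"
  shows "f (inv g) = f g"
proof -
  interpret group G using group_hom group_hom.axioms(1) by blast
  show ?thesis
  proof (cases "g \<in> derangements G E \<phi>")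
    case True
    then show ?thesis using f by (simp add: compatible_class_function_def)
  next
    case False
    then obtain x where "x \<in> E" "\<phi> g x = x"
      using g by (auto simp: derangements_def invariants_def)
    then have "x \<in> E" "\<phi> (inv g) x = x" using orbit_sym_aux[OF g] by auto
    then have "inv g \<notin> derangements G E \<phi>" by (auto simp: derangements_def invariants_def)
    then show ?thesis using f False g by (simp add: compatible_class_function_def)
  qed
qed

text \<open>The weighted ratio bound of Delsarte and Hoffman. For an intersecting set \<open>T\<close> with indicator \<open>v\<close> one
  has \<open>\<langle>v, M v\<rangle> = 0\<close>, because \<open>f\<close> vanishes on every \<open>\<sigma> \<otimes> inv \<tau>\<close> with \<open>\<sigma>, \<tau> \<in> T\<close>. Let
  \<open>w = v - |T| / |G|\<close> be the component of \<open>v\<close> orthogonal to the constants. Then \<open>\<langle>w, M w\<rangle>\<close> and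
  \<open>\<langle>w, w\<rangle>\<close> depend on \<open>|T|\<close> only, and the Rayleigh inequality for \<open>w\<close> is the bound. In the case of
  equality \<open>w\<close> attains the minimum of the Rayleigh quotient and is an eigenvector for \<open>k\<close>, so that \<open>v\<close>
  is one up to a constant. The bound is stated before division by \<open>|T|\<close>, which may be zero.\<close>

lemma (in group_action) ratio_bound:
  assumes fin: "finite (carrier G)"
    and f: "compatible_class_function G E \<phi> f"
    and least: "least_eigenvalue_on (carrier G) (class_function_matrix G f) k"
    and T: "intersecting_set G E \<phi> T"
    and d: "d = (\<Sum>g\<in>carrier G. f g)"
  shows "(d - k) * real (card T) ^ 2 \<le> - k * real (card (carrier G)) * real (card T)"
    and "(d - k) * real (card T) = - k * real (card (carrier G)) \<Longrightarrow> x \<in> carrier G \<Longrightarrow>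
      apply_on (carrier G) (class_function_matrix G f) (indicator T) x =
        k * indicator T x + (d - k) * real (card T) / real (card (carrier G))"
proof -
  interpret group G using group_hom group_hom.axioms(1) by blast
  define I where "I = carrier G"
  define M where "M = class_function_matrix G f"
  define N where "N = real (card (carrier G))"
  define t where "t = real (card T)"
  define v where "v = (indicator T :: 'a \<Rightarrow> real)"
  define w where "w = (\<lambda>x. v x - t / N * 1)"
  have finI: "finite I" and TI: "T \<subseteq> I" using fin T by (auto simp: I_def intersecting_set_def)
  have N: "N > 0" using fin one_closed by (auto simp: N_def card_gt_0_iff)
  have M_sym: "M i j = M j i" if "i \<in> I" "j \<in> I" for i j
    using class_function_matrix_symmetric[where f = f, OF compatible_class_function_inv[OF f]] that
    by (simp add: M_def I_def)
  have M_one: "apply_on I M (\<lambda>x. 1) x = d" if "x \<in> I" for x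
    using apply_on_class_function_matrix[of x f "\<lambda>x. 1"] that by (simp add: d I_def M_def)
  have v_sum: "inner_on I v g = (\<Sum>x\<in>T. g x)" for g
  proof -
    have "inner_on I v g = (\<Sum>x\<in>I. if x \<in> T then g x else 0)"
      unfolding inner_on_def v_def by (intro sum.cong) (auto simp: indicator_def)
    also have "\<dots> = (\<Sum>x\<in>I \<inter> T. g x)" by (simp add: sum.inter_restrict[OF finI])
    also have "I \<inter> T = T" using TI by blast
    finally show ?thesis .
  qed
  have vv: "inner_on I v v = t" and v1: "inner_on I v (\<lambda>x. 1) = t"
    by (simp_all add: v_sum t_def) (simp add: v_def)
  have one1: "inner_on I (\<lambda>x. 1) (\<lambda>x. 1) = N" by (simp add: inner_on_def N_def I_def)
  have vMv: "inner_on I v (apply_on I M v) = 0"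
  proof -
    have "f (\<sigma> \<otimes> inv \<tau>) = 0" if \<sigma>\<tau>: "\<sigma> \<in> T" "\<tau> \<in> T" for \<sigma> \<tau>
    proof -
      obtain \<alpha> where "\<alpha> \<in> E" "\<phi> (\<sigma> \<otimes> inv \<tau>) \<alpha> = \<alpha>"
        using T \<sigma>\<tau> unfolding intersecting_set_def by blast
      then have "\<sigma> \<otimes> inv \<tau> \<notin> derangements G E \<phi>" by (auto simp: derangements_def invariants_def)
      moreover have "\<sigma> \<otimes> inv \<tau> \<in> carrier G" using \<sigma>\<tau> TI by (auto simp: I_def)
      ultimately show ?thesis using f by (simp add: compatible_class_function_def)
    qed
    moreover have "apply_on I M v x = (\<Sum>y\<in>T. f (x \<otimes> inv y))" for x
      using v_sum[of "M x"]
      by (simp add: apply_on_def inner_on_def mult.commute M_def class_function_matrix_def)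
    ultimately show ?thesis by (simp add: v_sum)
  qed
  have M1: "inner_on I g (apply_on I M (\<lambda>x. 1)) = d * inner_on I g (\<lambda>x. 1)" for g
    by (simp add: inner_on_def M_one sum_distrib_left mult.commute)
  have "inner_on I (\<lambda>x. 1) (apply_on I M v) = d * t"
    using inner_on_apply_on_symmetric[of I M "\<lambda>x. 1" v] M_sym M1[of v] v1
    by (simp add: inner_on_commute[of I _ v])
  then have wMw: "inner_on I w (apply_on I M w) = - d * t\<^sup>2 / N"
    unfolding w_def apply_on_diff apply_on_scale inner_on_linear M1 v1 vMv one1
    using N by (simp add: field_simps power2_eq_square)
  have ww: "inner_on I w w = t - t\<^sup>2 / N"
    unfolding w_def inner_on_linear v1 vv one1 inner_on_commute[of I "\<lambda>x. 1" v]
    using N by (simp add: field_simps power2_eq_square)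
  note rayleigh = least_eigenvalue_rayleigh[OF finI M_sym least[folded I_def M_def]]
  have "k * (t - t\<^sup>2 / N) \<le> - d * t\<^sup>2 / N" using rayleigh[of w] by (simp only: wMw ww)
  then have "N * (k * (t - t\<^sup>2 / N)) \<le> N * (- d * t\<^sup>2 / N)"
    using N by (intro mult_left_mono) auto
  then show "(d - k) * real (card T) ^ 2 \<le> - k * real (card (carrier G)) * real (card T)"
    using N by (simp add: t_def[symmetric] N_def[symmetric] algebra_simps)
  assume eq: "(d - k) * real (card T) = - k * real (card (carrier G))" and x: "x \<in> carrier G"
  then have "(d - k) * t = - k * N" by (simp add: t_def N_def)
  then have dt: "d * t = k * t - k * N" by (simp add: algebra_simps)
  have "- d * t\<^sup>2 / N = - (d * t) * t / N" by (simp add: power2_eq_square)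
  also have "\<dots> = k * (t - t\<^sup>2 / N)"
    unfolding dt using N by (simp add: power2_eq_square field_simps)
  finally have "inner_on I w (apply_on I M w) = k * inner_on I w w" by (simp only: wMw ww)
  then have "apply_on I M w x = k * w x"
    using x by (intro eigenvector_if_rayleigh_minimum[OF finI M_sym rayleigh]) (auto simp: I_def)
  moreover have "apply_on I M w x = apply_on I M v x - t / N * d"
    unfolding w_def apply_on_diff apply_on_scale using M_one[of x] x by (simp add: I_def)
  ultimately have "apply_on I M v x = k * v x + (d - k) * t / N"
    using N by (simp add: w_def field_simps)
  then show "apply_on (carrier G) (class_function_matrix G f) (indicator T) x =
        k * indicator T x + (d - k) * real (card T) / real (card (carrier G))"
    by (simp add: I_def M_def v_def t_def N_def)
qed

text \<open>The constant functions are eigenvectors for the row sum of the matrix.\<close>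

lemma (in group) le_degree_if_least_eigenvalue:
  assumes fin: "finite (carrier G)"
    and least: "least_eigenvalue_on (carrier G) (class_function_matrix G f) k"
  shows "k \<le> (\<Sum>g\<in>carrier G. f g)"
proof -
  have "eigenvalue_on (carrier G) (class_function_matrix G f) (\<Sum>g\<in>carrier G. f g)"
    unfolding eigenvalue_on_def
  proof (intro exI[of _ "\<lambda>x. 1"] conjI ballI)
    show "\<exists>i\<in>carrier G. (1::real) \<noteq> 0" using one_closed by auto
    show "(\<Sum>j\<in>carrier G. class_function_matrix G f i j * 1) = (\<Sum>g\<in>carrier G. f g) * 1"
      if "i \<in> carrier G" for i
      using apply_on_class_function_matrix[OF that, of f "\<lambda>x. 1"] by (simp add: apply_on_def)
  qed
  then show ?thesis using least by (simp add: least_eigenvalue_on_def)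
qed

section \<open>Maximum intersecting sets in the action on cosets\<close>

theorem theorem3p4:
  fixes G :: "('a, 'c) monoid_scheme" (structure)
    and H S :: "'a set"
    and f :: "'a \<Rightarrow> real"
    and d \<tau> :: real
  assumes "group G"
    and "finite (carrier G)"
    and "subgroup H G"
    and "intersecting_set G (lcosets H) (lcoset_action G H) S"
    and "compatible_class_function G (lcosets H) (lcoset_action G H) f"
    and "d = (\<Sum>g\<in>carrier G. f g)"
    and "least_eigenvalue_on (carrier G) (class_function_matrix G f) \<tau>"
    and "d \<noteq> \<tau>"
    and "real (card S) = real (card (carrier G)) * (- \<tau>) / (d - \<tau>)"
  shows "(\<exists>T. maximum_intersecting_set G (lcosets H) (lcoset_action G H) T \<and> card T = card S) \<and>
    ({\<chi> \<in> Irr G. 1 / \<chi> \<one> * (\<Sum>g\<in>carrier G. complex_of_real (f g) * \<chi> g) = complex_of_real \<tau>}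
        \<subseteq> {\<chi> \<in> Irr G. character_sum \<chi> H \<noteq> 0}
      \<longrightarrow> EKR_module_property G (lcosets H) (lcoset_action G H))"
proof -
  interpret group G by fact
  interpret transitive_action G "lcosets H" "lcoset_action G H"
    by (rule lcoset_action_transitive) fact
  have pos: "d - \<tau> > 0"
    using le_degree_if_least_eigenvalue[OF assms(2,7)] assms(6,8) by simp
  have S_eq: "(d - \<tau>) * real (card S) = - \<tau> * real (card (carrier G))"
    using assms(9) pos by (simp add: field_simps)
  have bound: "card T \<le> card S" if T: "intersecting_set G (lcosets H) (lcoset_action G H) T" for T
  proof (cases "card T = 0")
    case False
    have "((d - \<tau>) * real (card T)) * real (card T) \<le> (- \<tau> * real (card (carrier G))) * real (card T)"
      using ratio_bound(1)[OF assms(2,5,7) T assms(6)] by (simp add: power2_eq_square mult.assoc)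
    then have "(d - \<tau>) * real (card T) \<le> (d - \<tau>) * real (card S)"
      using False S_eq by (simp del: mult_minus_left)
    then show ?thesis using pos by simp
  qed simp
  have max_S: "maximum_intersecting_set G (lcosets H) (lcoset_action G H) S"
    using assms(4) bound by (simp add: maximum_intersecting_set_def)
  moreover have "EKR_module_property G (lcosets H) (lcoset_action G H)"
    if sub: "{\<chi> \<in> Irr G. 1 / \<chi> \<one> * (\<Sum>g\<in>carrier G. complex_of_real (f g) * \<chi> g) = complex_of_real \<tau>}
        \<subseteq> {\<chi> \<in> Irr G. character_sum \<chi> H \<noteq> 0}"
    unfolding EKR_module_property_def
  proof (intro allI impI)
    fix T assume max_T: "maximum_intersecting_set G (lcosets H) (lcoset_action G H) T"
    then have T: "intersecting_set G (lcosets H) (lcoset_action G H) T"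
      by (simp add: maximum_intersecting_set_def)
    then have TG: "T \<subseteq> carrier G" by (simp add: intersecting_set_def)
    have "card T = card S"
      using max_T bound[OF T] assms(4) by (simp add: maximum_intersecting_set_def le_antisym)
    then have T_eq: "(d - \<tau>) * real (card T) = - \<tau> * real (card (carrier G))" using S_eq by simp
    have "class_function G f" using assms(5) by (simp add: compatible_class_function_def)
    then obtain C where C: "\<forall>x\<in>carrier G. indicator T x = (\<Sum>\<alpha>\<in>lcosets H. \<Sum>\<beta>\<in>lcosets H.
        C \<alpha> \<beta> * indicator {t \<in> carrier G. lcoset_action G H t \<alpha> = \<beta>} x :: real)"
      using in_canonical_span_if_shifted_eigenvector[OF assms(2,3) _ _
          compatible_class_function_inv[OF assms(5)]
          ratio_bound(2)[OF assms(2,5,7) T assms(6) T_eq]] sub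
      by blast
    show "\<exists>c. char_vec T = (\<lambda>g. \<Sum>\<alpha>\<in>lcosets H. \<Sum>\<beta>\<in>lcosets H.
        c \<alpha> \<beta> * canonical_vec G (lcoset_action G H) \<alpha> \<beta> g)"
    proof (intro exI[of _ "\<lambda>\<alpha> \<beta>. complex_of_real (C \<alpha> \<beta>)"] ext)
      have of_real_indicator: "complex_of_real (indicator A x) = indicator A x" for A and x :: 'a
        by (simp add: indicator_def)
      fix g
      show "char_vec T g = (\<Sum>\<alpha>\<in>lcosets H. \<Sum>\<beta>\<in>lcosets H.
          complex_of_real (C \<alpha> \<beta>) * canonical_vec G (lcoset_action G H) \<alpha> \<beta> g)"
      proof (cases "g \<in> carrier G")
        case True
        have "char_vec T g = complex_of_real (indicator T g)"
          by (simp add: char_vec_def of_real_indicator)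
        also have "\<dots> = complex_of_real (\<Sum>\<alpha>\<in>lcosets H. \<Sum>\<beta>\<in>lcosets H.
            C \<alpha> \<beta> * indicator {t \<in> carrier G. lcoset_action G H t \<alpha> = \<beta>} g)"
          using C True by simp
        finally show ?thesis
          by (simp add: canonical_vec_def char_vec_def of_real_indicator)
      next
        case False
        then show ?thesis using TG by (auto simp: canonical_vec_def char_vec_def indicator_def)
      qed
    qed
  qed
  ultimately show ?thesis by blast
qed

end
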